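(* For every $k\geq3$, $$H_{21\mbox{-}3\mbox{-}\cdots\mbox{-}k}(x)=\frac{x}{U_k^2\left(\frac{1}{2\sqrt{x}}\right)}\left(\sum_{j=1}^{k-2}U_j^2\left(\frac{1}{2\sqrt{x}}\right)-1\right).$$
   Context: A generalized pattern is a permutation of $\{1,\dots,k\}$ written as a word $\tau_1\cdots\tau_k$ in which each pair of adjacent letters may or may not be separated by a dash "-". An occurrence of $\tau$ in $\pi=\pi_1\cdots\pi_n\in S_n$ is a choice of indices $i_1<\dots<i_k$ with $(\pi_{i_1},\dots,\pi_{i_k})$ order-isomorphic to $(\tau_1,\dots,\tau_k)$ and $i_{j+1}=i_j+1$ whenever $\tau_j,\tau_{j+1}$ are not separated by a dash; $\pi$ avoids $\tau$ if there is no occurrence. $1\mbox{-}3\mbox{-}2$ is the classical pattern $132$. $H_\tau(x)=\sum_{n\geq0}h_\tau(n)x^n$ where $h_\tau(n)$ is the number of permutations in $S_n$ avoiding $\tau$ and containing exactly one occurrence of $1\mbox{-}3\mbox{-}2$. $U_p$ is the Chebyshev polynomial of the second kind, $U_p(\cos\theta)=\sin((p+1)\theta)/\sin\theta$. *)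

theory Defs
  imports
    Complex_Main
    "HOL-Computational_Algebra.Computational_Algebra"
    "HOL-Combinatorics.Multiset_Permutations"
begin

text \<open>
  A generalized pattern is a pair \<open>(\<tau>, J)\<close>: the word \<open>\<tau>\<close>, and the set \<open>J\<close> of the (0-based)
  positions \<open>j\<close> such that the letters at positions \<open>j\<close> and \<open>Suc j\<close> are \<^emph>\<open>not\<close> separated by a dash.
  Permutations in \<open>S\<^sub>n\<close> are words, i.e. elements of \<^term>\<open>permutations_of_set {1..n::nat}\<close>, and an
  occurrence is the increasing list of its (0-based) positions.
\<close>

type_synonym gpattern = "nat list \<times> nat set"

definition order_isomorphic :: "nat list \<Rightarrow> nat list \<Rightarrow> bool" where
  "order_isomorphic u v \<longleftrightarrow> length u = length v \<and>
     (\<forall>a<length u. \<forall>b<length u. u ! a < u ! b \<longleftrightarrow> v ! a < v ! b)"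

definition occurrences :: "gpattern \<Rightarrow> nat list \<Rightarrow> nat list set" where
  "occurrences p \<pi> = (case p of (\<tau>, J) \<Rightarrow>
     {is. sorted_wrt (<) is \<and> set is \<subseteq> {..<length \<pi>} \<and>
          order_isomorphic (map (nth \<pi>) is) \<tau> \<and>
          (\<forall>j\<in>J. Suc j < length \<tau> \<longrightarrow> is ! Suc j = Suc (is ! j))})"

definition avoids :: "nat list \<Rightarrow> gpattern \<Rightarrow> bool" where
  "avoids \<pi> p \<longleftrightarrow> occurrences p \<pi> = {}"

definition pat_1_3_2 :: gpattern where
  "pat_1_3_2 = ([1, 3, 2], {})"

text \<open>The pattern \<open>21-3-\<dots>-k\<close>, for \<open>k \<ge> 2\<close>.\<close>

definition pat_21_3_to :: "nat \<Rightarrow> gpattern" where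
  "pat_21_3_to k = ([2, 1] @ [3..<Suc k], {0})"

definition h :: "gpattern \<Rightarrow> nat \<Rightarrow> nat" where
  "h p n = card {\<pi> \<in> permutations_of_set {1..n}.
                   avoids \<pi> p \<and> card (occurrences pat_1_3_2 \<pi>) = 1}"

definition H :: "gpattern \<Rightarrow> real fps" where
  "H p = Abs_fps (\<lambda>n. of_nat (h p n))"

definition cheb_U :: "nat \<Rightarrow> real poly" where
  "cheb_U p = (THE q. \<forall>\<theta>. sin \<theta> \<noteq> 0 \<longrightarrow>
     poly q (cos \<theta>) = sin (real (p + 1) * \<theta>) / sin \<theta>)"

text \<open>
  The value \<open>U\<^sub>p(1/(2\<surd>x))\<close> as a formal Laurent series in the variable \<open>z = \<surd>x\<close>.
\<close>

definition U_at :: "nat \<Rightarrow> real fls" where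
  "U_at p = poly (map_poly fls_const (cheb_U p)) (1 / (2 * fls_X))"

lemma finite_occurrences: "finite (occurrences p \<pi>)"
proof -
  obtain \<tau> J where p: "p = (\<tau>, J)" by (cases p)
  have "occurrences p \<pi> \<subseteq> {is. set is \<subseteq> {..<length \<pi>} \<and> length is = length \<tau>}"
    by (auto simp: p occurrences_def order_isomorphic_def)
  thus ?thesis by (rule finite_subset) (simp add: finite_lists_length_eq)
qed

lemma cheb_U_unique:
  assumes "\<forall>\<theta>. sin \<theta> \<noteq> 0 \<longrightarrow> poly q (cos \<theta>) = sin (real (p + 1) * \<theta>) / sin \<theta>"
    and "\<forall>\<theta>. sin \<theta> \<noteq> 0 \<longrightarrow> poly r (cos \<theta>) = sin (real (p + 1) * \<theta>) / sin \<theta>"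
  shows "q = (r :: real poly)"
proof (rule ccontr)
  assume "q \<noteq> r"
  hence "finite {t. poly (q - r) t = 0}" by (intro poly_roots_finite) auto
  moreover have "{-1<..<1} \<subseteq> {t. poly (q - r) t = 0}"
  proof
    fix t :: real assume t: "t \<in> {-1<..<1}"
    hence "cos (arccos t) = t" "sin (arccos t) \<noteq> 0"
      using sin_arccos_nonzero[of t] by auto
    thus "t \<in> {t. poly (q - r) t = 0}" using assms by (metis (mono_tags) mem_Collect_eq poly_diff diff_self)
  qed
  ultimately have "finite {-1<..<(1::real)}" by (rule finite_subset[rotated])
  thus False by (simp add: infinite_Ioo)
qed

fun cheb_U_rec :: "nat \<Rightarrow> real poly" where
  "cheb_U_rec 0 = 1"
| "cheb_U_rec (Suc 0) = [:0, 2:]"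
| "cheb_U_rec (Suc (Suc p)) = [:0, 2:] * cheb_U_rec (Suc p) - cheb_U_rec p"

lemma cheb_U_rec_cos:
  "poly (cheb_U_rec p) (cos \<theta>) * sin \<theta> = sin (real (p + 1) * \<theta>)"
proof (induction p rule: cheb_U_rec.induct)
  case (3 p)
  define a where "a = real (Suc p + 1) * \<theta>"
  have "sin (a + \<theta>) + sin (a - \<theta>) = 2 * cos \<theta> * sin a"
    by (simp add: sin_add sin_diff)
  moreover have "a + \<theta> = real (Suc (Suc p) + 1) * \<theta>" "a - \<theta> = real (p + 1) * \<theta>"
    by (simp_all add: a_def algebra_simps)
  ultimately show ?case using 3 by (simp add: algebra_simps a_def)
qed (simp_all add: sin_double)

lemma cheb_U_eq_rec: "cheb_U p = cheb_U_rec p"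
  unfolding cheb_U_def
proof (rule the_equality)
  show "\<forall>\<theta>. sin \<theta> \<noteq> 0 \<longrightarrow> poly (cheb_U_rec p) (cos \<theta>) = sin (real (p + 1) * \<theta>) / sin \<theta>"
    using cheb_U_rec_cos[of p] by (simp add: nonzero_eq_divide_eq)
  thus "q = cheb_U_rec p"
    if "\<forall>\<theta>. sin \<theta> \<noteq> 0 \<longrightarrow> poly q (cos \<theta>) = sin (real (p + 1) * \<theta>) / sin \<theta>" for q
    using that by (rule cheb_U_unique[rotated])
qed

lemma cheb_U_cos:
  "sin \<theta> \<noteq> 0 \<Longrightarrow> poly (cheb_U p) (cos \<theta>) = sin (real (p + 1) * \<theta>) / sin \<theta>"
  using cheb_U_rec_cos[of p \<theta>] by (simp add: cheb_U_eq_rec nonzero_eq_divide_eq)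

lemma U_at_0: "U_at 0 = 1"
  by (simp add: U_at_def cheb_U_eq_rec)

lemma U_at_1: "U_at (Suc 0) = 1 / fls_X"
  by (simp add: U_at_def cheb_U_eq_rec map_poly_pCons flip: fls_of_nat)

end

theory Submission
  imports Defs "HOL-Library.Sublist" "HOL-Library.Infinite_Set"
begin

text \<open>
  Write \<open>\<pi> = u n v\<close> around its largest letter \<open>n\<close>. If \<open>\<pi>\<close> has exactly one occurrence of
  \<open>1-3-2\<close>, then either every letter of \<open>u\<close> exceeds every letter of \<open>v\<close> and the occurrence lies in
  \<open>u\<close> or in \<open>v\<close>; or the occurrence is \<open>a n (a+1)\<close>, where \<open>a\<close> is the last and smallest letter of \<open>u\<close>,
  \<open>a+1\<close> is the largest letter of \<open>v\<close>, and \<open>u\<close>, \<open>v\<close> both avoid \<open>1-3-2\<close>. In all cases \<open>\<pi>\<close>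
  avoids \<open>21-3-\<dots>-k\<close> iff \<open>u\<close> avoids \<open>21-3-\<dots>-(k-1)\<close> and \<open>v\<close> avoids \<open>21-3-\<dots>-k\<close>.

  With \<open>F\<^sub>k\<close> counting the permutations that avoid \<open>1-3-2\<close> and \<open>21-3-\<dots>-k\<close>, this gives
  \<open>F\<^sub>k = 1 + x F\<^sub>k\<^sub>-\<^sub>1 F\<^sub>k\<close> and
  \<open>H\<^sub>k = x (H\<^sub>k\<^sub>-\<^sub>1 F\<^sub>k + F\<^sub>k\<^sub>-\<^sub>1 H\<^sub>k) + x\<^sup>2 G\<^sub>k\<^sub>-\<^sub>1 (F\<^sub>k - 1)\<close>, where \<open>G\<^sub>2 = 1\<close> and
  \<open>G\<^sub>k = F\<^sub>k\<close> for \<open>k \<ge> 3\<close>. Put \<open>W\<^sub>p = x\<^bsup>p/2\<^esup> U\<^sub>p(1/(2\<surd>x))\<close>. Then \<open>F\<^sub>k = W\<^sub>k\<^sub>-\<^sub>1 / W\<^sub>k\<close>, and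
  \<open>H\<^sub>k W\<^sub>k\<^sup>2 = x H\<^sub>k\<^sub>-\<^sub>1 W\<^sub>k\<^sub>-\<^sub>1\<^sup>2 + x\<^sup>3 W\<^sub>k\<^sub>-\<^sub>2\<^sup>2\<close> for \<open>k \<ge> 4\<close> telescopes to the claim.

  The pattern \<open>21-3-\<dots>-k\<close> is indexed below by \<open>r = k - 2\<close>, the length of its rise \<open>3-\<dots>-k\<close>.
\<close>

section \<open>Occurrences of 1-3-2 around the maximum\<close>

primrec num32_above :: "nat \<Rightarrow> nat list \<Rightarrow> nat" where
  "num32_above x [] = 0"
| "num32_above x (y # w) = length (filter (\<lambda>z. x < z \<and> z < y) w) + num32_above x w"

text \<open>Recursion on the word replaces sets of positions, so that concatenation can be handled
  by induction; \<open>card_occurrences_132\<close> identifies the value with the number of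
  occurrences.\<close>

primrec num132 :: "nat list \<Rightarrow> nat" where
  "num132 [] = 0"
| "num132 (x # w) = num32_above x w + num132 w"

text \<open>The occurrences of \<open>1-3-2\<close> whose letters \<open>1\<close> and \<open>3\<close> lie in the first word and \<open>2\<close> in the second.\<close>

primrec num13_2 :: "nat list \<Rightarrow> nat list \<Rightarrow> nat" where
  "num13_2 [] v = 0"
| "num13_2 (x # u) v = (\<Sum>y\<leftarrow>u. length (filter (\<lambda>z. x < z \<and> z < y) v)) + num13_2 u v"

lemma num32_above_append:
  "num32_above x (u @ v) = num32_above x u + num32_above x v
     + (\<Sum>y\<leftarrow>u. length (filter (\<lambda>z. x < z \<and> z < y) v))"
  by (induction u) auto

text \<open>An occurrence has three, none, one or two of its letters in \<open>u\<close>; this is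
  the order of the summands.\<close>

lemma num132_append:
  "num132 (u @ v) = num132 u + num132 v + (\<Sum>x\<leftarrow>u. num32_above x v) + num13_2 u v"
  by (induction u) (auto simp: num32_above_append)

lemma num13_2_append_left:
  "num13_2 (u @ u') v = num13_2 u v + num13_2 u' v
     + (\<Sum>x\<leftarrow>u. \<Sum>y\<leftarrow>u'. length (filter (\<lambda>z. x < z \<and> z < y) v))"
  by (induction u) auto

lemma card_num32_above:
  "card {(j, l). j < l \<and> l < length w \<and> x < w ! l \<and> w ! l < w ! j} = num32_above x w"
  (is "card (?S w) = _")
proof (induction w)
  case Nil
  show ?case by simp
next
  case (Cons y w)
  let ?T = "{l. l < length w \<and> x < w ! l \<and> w ! l < y}"
  have split: "?S (y # w) = (\<lambda>l. (0, Suc l)) ` ?T \<union> map_prod Suc Suc ` ?S w"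
    (is "_ = ?A \<union> ?B")
  proof (intro equalityI subsetI)
    fix p assume "p \<in> ?S (y # w)"
    then obtain j l where p: "p = (j, l)" "j < l" "l < Suc (length w)"
      "x < (y # w) ! l" "(y # w) ! l < (y # w) ! j" by auto
    from p(2) obtain l' where l': "l = Suc l'" by (cases l) auto
    show "p \<in> ?A \<union> ?B"
      using p l' by (cases j) (auto simp: image_iff)
  qed auto
  have fin: "finite (?S w)"
    by (rule finite_subset[of _ "{..<length w} \<times> {..<length w}"]) auto
  have "card (?S (y # w)) = card ?A + card ?B"
    unfolding split by (rule card_Un_disjoint) (use fin in auto)
  also have "card ?A = card ?T" by (rule card_image) (auto simp: inj_on_def)
  also have "card ?B = card (?S w)" by (rule card_image) (auto simp: inj_on_def)
  finally show ?case by (simp add: Cons.IH length_filter_conv_card)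
qed

text \<open>Triples of positions split by whether the first one is 0: those are the pairs of
  \<open>card_num32_above\<close>, and all others are shifted triples of the tail.\<close>

lemma card_num132:
  "card {(i, j, l). i < j \<and> j < l \<and> l < length w \<and> w ! i < w ! l \<and> w ! l < w ! j} = num132 w"
  (is "card (?S w) = _")
proof (induction w)
  case Nil
  show ?case by simp
next
  case (Cons y w)
  let ?T = "{(j, l). j < l \<and> l < length w \<and> y < w ! l \<and> w ! l < w ! j}"
  have split: "?S (y # w) = (\<lambda>(j, l). (0, Suc j, Suc l)) ` ?T
      \<union> map_prod Suc (map_prod Suc Suc) ` ?S w" (is "_ = ?A \<union> ?B")
  proof (intro equalityI subsetI)
    fix p assume "p \<in> ?S (y # w)"
    then obtain i j l where p: "p = (i, j, l)" "i < j" "j < l" "l < Suc (length w)"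
      "(y # w) ! i < (y # w) ! l" "(y # w) ! l < (y # w) ! j" by auto
    from p obtain l' j' where l': "l = Suc l'" "j = Suc j'" by (cases l; cases j) auto
    show "p \<in> ?A \<union> ?B"
      using p l' by (cases i) (auto simp: image_iff)
  qed auto
  have fin: "finite (?S w)"
    by (rule finite_subset[of _ "{..<length w} \<times> {..<length w} \<times> {..<length w}"]) auto
  have finT: "finite ?T"
    by (rule finite_subset[of _ "{..<length w} \<times> {..<length w}"]) auto
  have "card (?S (y # w)) = card ?A + card ?B"
    unfolding split by (rule card_Un_disjoint) (use fin finT in auto)
  also have "card ?A = card ?T" by (rule card_image) (auto simp: inj_on_def)
  also have "card ?B = card (?S w)" by (rule card_image) (auto simp: inj_on_def)
  finally show ?case by (simp add: Cons.IH card_num32_above)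
qed

lemma order_isomorphic_132_iff:
  "order_isomorphic [x, y, z] [Suc 0, 3, 2] \<longleftrightarrow> x < z \<and> z < y"
  by (auto simp: order_isomorphic_def All_less_Suc)

lemma card_occurrences_132: "card (occurrences pat_1_3_2 w) = num132 w"
proof -
  let ?S = "{(i, j, l). i < j \<and> j < l \<and> l < length w \<and> w ! i < w ! l \<and> w ! l < w ! j}"
  have "occurrences pat_1_3_2 w = (\<lambda>(i, j, l). [i, j, l]) ` ?S"
  proof (intro equalityI subsetI)
    fix ns assume "ns \<in> occurrences pat_1_3_2 w"
    hence *: "sorted_wrt (<) ns" "set ns \<subseteq> {..<length w}"
      "order_isomorphic (map (nth w) ns) [1, 3, 2]"
      by (auto simp: occurrences_def pat_1_3_2_def)
    then obtain i j l where ns: "ns = [i, j, l]"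
      by (auto simp: order_isomorphic_def length_Suc_conv)
    show "ns \<in> (\<lambda>(i, j, l). [i, j, l]) ` ?S"
      using * by (auto simp: ns image_iff order_isomorphic_132_iff)
  next
    fix ns assume "ns \<in> (\<lambda>(i, j, l). [i, j, l]) ` ?S"
    thus "ns \<in> occurrences pat_1_3_2 w"
      by (auto simp: occurrences_def pat_1_3_2_def order_isomorphic_132_iff)
  qed
  hence "card (occurrences pat_1_3_2 w) = card ?S"
    by (simp add: card_image inj_on_def)
  thus ?thesis by (simp add: card_num132)
qed

section \<open>Inserting the maximum: effect on 1-3-2\<close>

lemma num132_insert_max:
  assumes "\<forall>z\<in>set u \<union> set v. z < m"
  shows "num132 (u @ m # v) = num132 u + num132 v
     + (\<Sum>x\<leftarrow>u. length (filter (\<lambda>z. x < z) v)) + (\<Sum>x\<leftarrow>u. num32_above x v) + num13_2 u v"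
proof -
  \<comment> \<open>The maximum can play neither 1 nor 2. Playing 3, it gives one occurrence for
    each \<open>x\<close> in \<open>u\<close> and \<open>z\<close> in \<open>v\<close> with
    \<open>x < z\<close>.\<close>
  have "num32_above m v = 0" if "\<forall>z\<in>set v. z < m" for v
    using that by (induction v) (auto simp: filter_empty_conv)
  moreover have "num13_2 u (m # v) = num13_2 u v" if "\<forall>z\<in>set u. z < m" for u
    using that by (induction u) (auto intro!: arg_cong[where f = sum_list], meson less_asym)
  moreover have "(\<Sum>x\<leftarrow>u. num32_above x (m # v))
      = (\<Sum>x\<leftarrow>u. length (filter (\<lambda>z. x < z) v)) + (\<Sum>x\<leftarrow>u. num32_above x v)"
    using assms by (auto simp: sum_list_addf intro!: arg_cong[where f = sum_list] arg_cong[where f = length] filter_cong)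
  ultimately show ?thesis using assms by (simp add: num132_append)
qed

text \<open>The letter playing 1 has the letter playing 3 after it within \<open>u\<close>, so it
  lies in \<open>butlast u\<close>. The last letter of \<open>u\<close> may thus be small, as in the
  \<open>only_inversion\<close> case.\<close>

lemma num13_2_eq_0:
  assumes "\<forall>x\<in>set (butlast u). \<forall>y\<in>set v. y < x"
  shows "num13_2 u v = 0"
  using assms by (induction u) (auto simp: filter_empty_conv split: if_splits dest: order.asym)

lemma num32_above_eq_0:
  assumes "\<forall>y\<in>set v. y < x"
  shows "num32_above x v = 0"
  using assms by (induction v) (auto simp: filter_empty_conv)

lemma num132_insert_max_separated:
  assumes "\<forall>z\<in>set u \<union> set v. z < m" "\<forall>x\<in>set u. \<forall>y\<in>set v. y < x"
  shows "num132 (u @ m # v) = num132 u + num132 v"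
proof -
  have "num13_2 u v = 0"
    by (rule num13_2_eq_0) (use assms(2) in \<open>auto dest: in_set_butlastD\<close>)
  moreover have "\<forall>x\<in>set u. num32_above x v = 0"
    using assms(2) num32_above_eq_0 by blast
  moreover have "\<forall>x\<in>set u. filter (\<lambda>z. x < z) v = []"
    using assms(2) by (auto simp: filter_empty_conv dest: order.asym)
  ultimately show ?thesis using num132_insert_max[OF assms(1)]
    by simp
qed

text \<open>The triple \<open>a m b\<close> is an occurrence contained in neither \<open>u\<close>
  nor \<open>v\<close>.\<close>

lemma num132_insert_max_pos:
  assumes "\<forall>z\<in>set u \<union> set v. z < m" "a \<in> set u" "b \<in> set v" "a < b"
  shows "num132 (u @ m # v) > num132 u + num132 v"
proof -
  have "length (filter (\<lambda>z. a < z) v) \<noteq> 0"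
    using assms by (auto simp: filter_empty_conv)
  moreover have "length (filter (\<lambda>z. a < z) v) \<le> (\<Sum>x\<leftarrow>u. length (filter (\<lambda>z. x < z) v))"
    by (rule member_le_sum_list) (use assms in auto)
  ultimately show ?thesis using num132_insert_max[OF assms(1)] by linarith
qed

lemma num132_insert_max_eq_0_iff:
  assumes "\<forall>z\<in>set u \<union> set v. z < m" "set u \<inter> set v = {}"
  shows "num132 (u @ m # v) = 0 \<longleftrightarrow>
    num132 u = 0 \<and> num132 v = 0 \<and> (\<forall>x\<in>set u. \<forall>y\<in>set v. y < x)"
proof (cases "\<forall>x\<in>set u. \<forall>y\<in>set v. y < x")
  case True
  thus ?thesis using num132_insert_max_separated[OF assms(1)] by auto
next
  case False
  then obtain a b where "a \<in> set u" "b \<in> set v" "a < b"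
    using assms(2) by (metis IntI empty_iff linorder_neqE_nat)
  thus ?thesis using num132_insert_max_pos[OF assms(1)] False by fastforce
qed

text \<open>A smallest last letter could only play 2, but 2 must exceed the letter playing
  1.\<close>

lemma num132_snoc_min:
  assumes "\<forall>x\<in>set s. a < x"
  shows "num132 (s @ [a]) = num132 s"
proof -
  have "num13_2 s [a] = 0" using assms by (induction s) (auto simp: sum_list_eq_0_iff)
  thus ?thesis by (simp add: num132_append)
qed

text \<open>With \<open>u = s @ [a]\<close>, the pair \<open>(a, b)\<close> is the single exception
  to \<open>u\<close> lying above \<open>v\<close>.\<close>

definition only_inversion :: "nat list \<Rightarrow> nat list \<Rightarrow> nat \<Rightarrow> nat \<Rightarrow> bool" where
  "only_inversion s v a b \<longleftrightarrow> b \<in> set v \<and> a < b \<and>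
     (\<forall>x\<in>set s. \<forall>y\<in>set v. y < x) \<and> (\<forall>y\<in>set v - {b}. y < a)"

text \<open>The additional 1 is the triple \<open>a m b\<close>; all other terms mixing the two
  words vanish.\<close>

lemma num132_only_inversion:
  assumes "\<forall>z\<in>set (s @ [a]) \<union> set v. z < m" "distinct v" "only_inversion s v a b"
  shows "num132 ((s @ [a]) @ m # v) = num132 s + num132 v + 1"
proof -
  note o = assms(3)[unfolded only_inversion_def]
  have 1: "num13_2 (s @ [a]) v = 0"
    by (rule num13_2_eq_0) (use o in auto)
  have 2: "\<forall>x\<in>set s. num32_above x v = 0"
    using o num32_above_eq_0 by blast
  have 3: "\<forall>x\<in>set s. filter (\<lambda>z. x < z) v = []"
    using o by (auto simp: filter_empty_conv dest: order.asym)
  have 4: "num132 (s @ [a]) = num132 s"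
    by (rule num132_snoc_min) (use o in \<open>meson less_trans\<close>)
  \<comment> \<open>A descending pair above \<open>a\<close> would need two different letters
    exceeding \<open>a\<close>, but only \<open>b\<close> can exceed it.\<close>
  have 5: "num32_above a v' = 0" if "\<forall>y\<in>set v' - {b}. y < a" for v'
  proof (rule ccontr)
    assume "num32_above a v' \<noteq> 0"
    then obtain y z where "y \<in> set v'" "z \<in> set v'" "a < z" "z < y"
      by (induction v') (auto simp: filter_empty_conv)
    thus False using that by (metis DiffI less_asym less_trans nat_neq_iff singletonD)
  qed
  have "{z \<in> set v. a < z} = {b}" using o by (auto dest: order.asym)
  hence 6: "length (filter (\<lambda>z. a < z) v) = 1"
    using assms(2) distinct_card[of "filter (\<lambda>z. a < z) v"] by simp
  show ?thesis
    using num132_insert_max[OF assms(1)] 1 2 3 4 6 5[of v] o by simp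
qed

text \<open>Once some \<open>a\<close> in \<open>u\<close> is below some \<open>b\<close> in
  \<open>v\<close>, the triple \<open>a m b\<close> is the one permitted occurrence, and excluding a
  second one determines the shape of \<open>u\<close> and \<open>v\<close>.\<close>

lemma num132_insert_max_eq_1_iff:
  assumes "\<forall>z\<in>set u \<union> set v. z < m" "set u \<inter> set v = {}" "distinct v"
  shows "num132 (u @ m # v) = 1 \<longleftrightarrow>
    num132 u + num132 v = 1 \<and> (\<forall>x\<in>set u. \<forall>y\<in>set v. y < x) \<or>
    (\<exists>s a b. u = s @ [a] \<and> only_inversion s v a b \<and> num132 s = 0 \<and> num132 v = 0)"
    (is "?L \<longleftrightarrow> ?R1 \<or> ?R2")
proof (cases "\<forall>x\<in>set u. \<forall>y\<in>set v. y < x")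
  case True
  have "\<not> ?R2"
  proof
    assume ?R2
    then obtain s a b where "u = s @ [a]" "b \<in> set v" "a < b" by (auto simp: only_inversion_def)
    thus False using True by fastforce
  qed
  thus ?thesis using num132_insert_max_separated[OF assms(1)] True by auto
next
  case False
  then obtain a b where ab: "a \<in> set u" "b \<in> set v" "a < b"
    using assms(2) by (metis IntI empty_iff linorder_neqE_nat)
  have "?R2" if L: ?L
  proof -
    obtain s r where u: "u = s @ a # r" using ab(1) by (meson split_list)
    \<comment> \<open>\<open>N x\<close> counts the occurrences \<open>x m z\<close>. Since
      \<open>N a\<close> is positive, a total of 1 leaves 0 for every other letter of
      \<open>u\<close> and for \<open>num13_2 u v\<close>.\<close>
    define N where "N = (\<lambda>x. length (filter (\<lambda>z. x < z) v))"
    have Na: "N a \<noteq> 0" using ab by (auto simp: N_def filter_empty_conv)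
    have sum: "(\<Sum>x\<leftarrow>s. N x) + N a + (\<Sum>x\<leftarrow>r. N x) + num13_2 u v \<le> 1"
      using num132_insert_max[OF assms(1)] L by (simp add: u N_def)
    hence "sum_list (map N s) = 0" "sum_list (map N r) = 0"
      and N1: "N a = 1" and P0: "num13_2 u v = 0"
      using Na by linarith+
    hence N0: "\<forall>x\<in>set s \<union> set r. N x = 0" by auto
    have less: "y < x" if "x \<in> set s \<union> set r" "y \<in> set v" for x y
    proof -
      have "\<not> x < y" using N0 that by (auto simp: N_def filter_empty_conv)
      moreover have "x \<noteq> y" using that assms(2) u by auto
      ultimately show ?thesis by simp
    qed
    \<comment> \<open>A letter \<open>y\<close> of \<open>u\<close> after \<open>a\<close> exceeds
      all of \<open>v\<close>, so \<open>a y b\<close> would be another occurrence.\<close>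
    have r: "r = []"
    proof (cases r)
      case (Cons y r')
      have "b < y" using less ab Cons by auto
      hence "filter (\<lambda>z. a < z \<and> z < y) v \<noteq> []" using ab by (auto simp: filter_empty_conv)
      thus ?thesis using P0 Cons by (simp add: u num13_2_append_left)
    qed
    \<comment> \<open>\<open>N a = 1\<close> makes \<open>b\<close> the only letter of
      \<open>v\<close> above \<open>a\<close>; distinctness turns the length of the filtered list
      into a cardinality.\<close>
    have "card {z \<in> set v. a < z} = 1"
      using N1 assms(3) distinct_card[of "filter (\<lambda>z. a < z) v"] by (simp add: N_def)
    then obtain c where "{z \<in> set v. a < z} = {c}" by (rule card_1_singletonE)
    hence "y = c" if "y \<in> set v" "a < y" for y using that by blast
    moreover have "a \<notin> set v" using ab assms(2) by auto
    ultimately have "\<forall>y\<in>set v - {b}. y < a" using ab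
      by (metis DiffD1 DiffD2 insertI1 linorder_neqE_nat)
    hence o: "only_inversion s v a b" using ab less by (auto simp: only_inversion_def)
    have "num132 ((s @ [a]) @ m # v) = num132 s + num132 v + 1"
      by (rule num132_only_inversion[OF _ assms(3) o]) (use assms(1) u r in auto)
    thus ?R2 using L u r o by auto
  qed
  moreover have "?L" if ?R2
  proof -
    from that obtain s a b where *: "u = s @ [a]" "only_inversion s v a b" "num132 s = 0" "num132 v = 0"
      by blast
    show ?L using num132_only_inversion[OF _ assms(3) *(2)] assms(1) * by simp
  qed
  ultimately show ?thesis using False by blast
qed

section \<open>Occurrences of 21-3-...-k around the maximum\<close>

text \<open>Containment of 21-3-...-k with \<open>k = r + 2\<close>, in list form: the missing dash
  makes \<open>a\<close> and \<open>b\<close> neighbours, and the dashes let the rise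
  \<open>s\<close> be any subsequence of what follows.\<close>

definition descent_rise :: "nat \<Rightarrow> nat list \<Rightarrow> bool" where
  "descent_rise r w \<longleftrightarrow> (\<exists>p a b q s. w = p @ a # b # q \<and> b < a \<and>
     subseq s q \<and> sorted_wrt (<) (a # s) \<and> length s = r)"

text \<open>Translates between the lists of positions in \<open>occurrences\<close> and the
  subsequences in \<open>descent_rise\<close>.\<close>

lemma subseq_conv_indices:
  "subseq s w \<longleftrightarrow> (\<exists>js. sorted_wrt (<) js \<and> set js \<subseteq> {..<length w} \<and> s = map (nth w) js)"
proof
  assume "subseq s w"
  thus "\<exists>js. sorted_wrt (<) js \<and> set js \<subseteq> {..<length w} \<and> s = map (nth w) js"
  proof (induction rule: list_emb.induct)
    case (list_emb_Nil ys)
    show ?case by (rule exI[of _ "[]"]) simp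
  next
    case (list_emb_Cons xs ys y)
    then obtain js where "sorted_wrt (<) js" "set js \<subseteq> {..<length ys}" "xs = map (nth ys) js" by auto
    thus ?case by (intro exI[of _ "map Suc js"]) (auto simp: sorted_wrt_map)
  next
    case (list_emb_Cons2 x y xs ys)
    then obtain js where "sorted_wrt (<) js" "set js \<subseteq> {..<length ys}" "xs = map (nth ys) js" by auto
    thus ?case using list_emb_Cons2 by (intro exI[of _ "0 # map Suc js"]) (auto simp: sorted_wrt_map)
  qed
next
  have "subseq (map (nth w) js) w" if "sorted_wrt (<) js" "set js \<subseteq> {..<length w}" for js
    using that
  proof (induction w arbitrary: js)
    case Nil
    thus ?case by simp
  next
    case (Cons x w)
    \<comment> \<open>Positions that are all positive point into the tail; lowering them by one
      makes the induction hypothesis applicable.\<close>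
    have shift: "subseq (map (nth (x # w)) is') w"
      if "sorted_wrt (<) is'" "set is' \<subseteq> {0<..<Suc (length w)}" for is'
    proof -
      have "map (nth (x # w)) is' = map (nth w) (map (\<lambda>j. j - 1) is')"
        using that by (auto simp: nth_Cons')
      moreover have "sorted_wrt (<) (map (\<lambda>j. j - 1) is')"
        unfolding sorted_wrt_map by (rule sorted_wrt_mono_rel[OF _ that(1)]) (use that in fastforce)
      moreover have "set (map (\<lambda>j. j - 1) is') \<subseteq> {..<length w}" using that by fastforce
      ultimately show ?thesis using Cons.IH by metis
    qed
    show ?case
    proof (cases "\<exists>js'. js = 0 # js'")
      case True
      then obtain js' where "js = 0 # js'" by blast
      moreover have "set js' \<subseteq> {0<..<Suc (length w)}"
        using Cons.prems \<open>js = 0 # js'\<close> by auto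
      ultimately show ?thesis using Cons.prems shift[of js'] by auto
    next
      case False
      have "0 \<notin> set js"
        using Cons.prems(1) False by (cases js) auto
      hence "set js \<subseteq> {0<..<Suc (length w)}"
        using Cons.prems(2) by (metis greaterThanLessThan_iff length_Cons lessThan_iff neq0_conv subset_eq)
      thus ?thesis using shift Cons.prems(1) by (intro list_emb_Cons)
    qed
  qed
  thus "\<exists>js. sorted_wrt (<) js \<and> set js \<subseteq> {..<length w} \<and> s = map (nth w) js \<Longrightarrow> subseq s w"
    by blast
qed

lemma order_isomorphic_21_3_to_iff:
  "order_isomorphic v ([2, 1] @ [3..<Suc (r + 2)]) \<longleftrightarrow>
     (\<exists>a b s. v = a # b # s \<and> b < a \<and> sorted_wrt (<) (a # s) \<and> length s = r)"
  (is "order_isomorphic v ?t \<longleftrightarrow> ?R")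
proof
  have t: "?t ! 0 = 2" "?t ! Suc 0 = 1" "j < r \<Longrightarrow> ?t ! Suc (Suc j) = j + 3" "length ?t = r + 2" for j
    by (simp_all del: upt_Suc)
  {
    assume *: "order_isomorphic v ?t"
    hence len: "length v = r + 2" using t by (simp add: order_isomorphic_def)
    then obtain a b s where v: "v = a # b # s" "length s = r"
      by (metis Suc_length_conv add_2_eq_Suc')
    have lt: "i < r + 2 \<Longrightarrow> j < r + 2 \<Longrightarrow> v ! i < v ! j \<longleftrightarrow> ?t ! i < ?t ! j" for i j
      using * len by (simp add: order_isomorphic_def)
    have "b < a" using lt[of 1 0] by (simp add: v del: upt_Suc)
    moreover have "\<forall>z\<in>set s. a < z"
    proof
      fix z assume "z \<in> set s"
      then obtain j where "z = s ! j" "j < r" using v by (auto simp: in_set_conv_nth)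
      thus "a < z" using lt[of 0 "Suc (Suc j)"] t by (simp add: v del: upt_Suc)
    qed
    moreover have "sorted_wrt (<) s"
      unfolding sorted_wrt_iff_nth_less
    proof (intro allI impI)
      fix i j assume "i < j" "j < length s"
      thus "s ! i < s ! j"
        using lt[of "Suc (Suc i)" "Suc (Suc j)"] t by (simp add: v del: upt_Suc)
    qed
    ultimately show ?R using v by auto
  next
    assume ?R
    then obtain a b s where v: "v = a # b # s" "b < a" "\<forall>z\<in>set s. a < z" "sorted_wrt (<) s" "length s = r"
      by auto
    have b: "\<forall>z\<in>set s. b < z" using v by (meson less_trans)
    have s: "s ! i < s ! j \<longleftrightarrow> i < j" if "i < r" "j < r" for i j
      using sorted_wrt_nth_less[OF v(4), of i j] sorted_wrt_nth_less[OF v(4), of j i] that v(5)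
      by (metis less_asym nat_neq_iff)
    show "order_isomorphic v ?t"
      unfolding order_isomorphic_def
    proof (intro conjI allI impI)
      show "length v = length ?t" using v t by simp
    next
      fix i j assume ij: "i < length v" "j < length v"
      have a': "a < s ! n \<and> b < s ! n \<and> \<not> s ! n < a \<and> \<not> s ! n < b" if "n < r" for n
        using that v(3,5) b nth_mem[of n s] by (metis less_asym)
      consider "i = 0" | "i = 1" | i' where "i = Suc (Suc i')" "i' < r"
        using ij v by (metis One_nat_def Suc_less_eq length_Cons not0_implies_Suc)
      note i_cases = this
      consider "j = 0" | "j = 1" | j' where "j = Suc (Suc j')" "j' < r"
        using ij v by (metis One_nat_def Suc_less_eq length_Cons not0_implies_Suc)
      thus "v ! i < v ! j \<longleftrightarrow> ?t ! i < ?t ! j"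
        by (cases; cases rule: i_cases) (use v a' s t in \<open>auto simp del: upt_Suc\<close>)
    qed
  }
qed

text \<open>The first two positions \<open>i\<close> and \<open>Suc i\<close> cut the word into
  \<open>p\<close>, \<open>a\<close>, \<open>b\<close>, \<open>q\<close>; the others, lowered by
  \<open>i + 2\<close>, become positions in \<open>q\<close>.\<close>

lemma avoids_21_3_to_iff: "avoids w (pat_21_3_to (r + 2)) \<longleftrightarrow> \<not> descent_rise r w"
proof -
  have "occurrences (pat_21_3_to (r + 2)) w \<noteq> {} \<longleftrightarrow> descent_rise r w"
  proof
    assume "occurrences (pat_21_3_to (r + 2)) w \<noteq> {}"
    then obtain ns where ns: "sorted_wrt (<) ns" "set ns \<subseteq> {..<length w}"
      "order_isomorphic (map (nth w) ns) ([2, 1] @ [3..<Suc (r + 2)])"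
      and adj: "ns ! Suc 0 = Suc (ns ! 0)"
      by (auto simp: occurrences_def pat_21_3_to_def simp del: upt_Suc)
    from ns(3) obtain a b s where *: "map (nth w) ns = a # b # s" "b < a"
      "sorted_wrt (<) (a # s)" "length s = r"
      unfolding order_isomorphic_21_3_to_iff by (elim exE conjE)
    from *(1) adj obtain i js where js: "ns = i # Suc i # js" "a = w ! i" "b = w ! Suc i"
      "s = map (nth w) js" by (auto simp: map_eq_Cons_conv)
    define q where "q = drop (Suc (Suc i)) w"
    have w: "w = take i w @ a # b # q"
      using ns(2) js by (simp add: q_def Cons_nth_drop_Suc)
    have bd: "\<forall>j\<in>set js. Suc (Suc i) \<le> j \<and> j < length w" and sjs: "sorted_wrt (<) js"
      using ns(1,2) js(1) by (auto simp: Suc_le_eq)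
    have "s = map (nth q) (map (\<lambda>j. j - Suc (Suc i)) js)"
    proof -
      have "w ! j = q ! (j - Suc (Suc i))" if "j \<in> set js" for j
      proof -
        obtain d where "j = Suc (Suc i) + d" using bd \<open>j \<in> set js\<close> le_Suc_ex by blast
        moreover have "Suc (Suc i) \<le> length w" using bd that by fastforce
        ultimately show ?thesis by (simp add: q_def)
      qed
      thus ?thesis using js(4) by simp
    qed
    moreover have "sorted_wrt (<) (map (\<lambda>j. j - Suc (Suc i)) js)"
      unfolding sorted_wrt_map by (rule sorted_wrt_mono_rel[OF _ sjs]) (use bd in \<open>simp add: diff_less_mono\<close>)
    moreover have "set (map (\<lambda>j. j - Suc (Suc i)) js) \<subseteq> {..<length q}"
      using bd by (auto simp: q_def diff_less_mono)
    ultimately have "subseq s q" unfolding subseq_conv_indices by (intro exI conjI)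
    with w *(2-4) show "descent_rise r w" unfolding descent_rise_def by (intro exI conjI)
  next
    assume "descent_rise r w"
    then obtain p a b q s where w: "w = p @ a # b # q" "b < a" "subseq s q"
      "sorted_wrt (<) (a # s)" "length s = r" unfolding descent_rise_def by blast
    then obtain js where js: "sorted_wrt (<) js" "set js \<subseteq> {..<length q}" "s = map (nth q) js"
      unfolding subseq_conv_indices by blast
    define ns where "ns = length p # Suc (length p) # map (\<lambda>j. Suc (Suc (length p)) + j) js"
    have m: "map (nth w) ns = a # b # s"
      by (simp add: ns_def w js nth_append)
    hence "order_isomorphic (map (nth w) ns) ([2, 1] @ [3..<Suc (r + 2)])"
      unfolding order_isomorphic_21_3_to_iff using w(2,4,5) by (intro exI conjI)
    moreover have "sorted_wrt (<) ns" "set ns \<subseteq> {..<length w}"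
      using js by (auto simp: ns_def w sorted_wrt_map)
    moreover have "ns ! Suc 0 = Suc (ns ! 0)" by (simp add: ns_def)
    ultimately have "ns \<in> occurrences (pat_21_3_to (r + 2)) w"
      by (simp add: occurrences_def pat_21_3_to_def del: upt_Suc)
    thus "occurrences (pat_21_3_to (r + 2)) w \<noteq> {}" by blast
  qed
  thus ?thesis by (auto simp: avoids_def)
qed

section \<open>Inserting the maximum or a last minimum: effect on 21-3-...-k\<close>

lemma subseq_set_subset: "subseq s q \<Longrightarrow> set s \<subseteq> set q"
  by (induction rule: list_emb.induct) auto

text \<open>The maximum can only end the rise. An occurrence with its descent in \<open>u\<close>
  loses at most that last letter when cut down to \<open>u\<close>, and conversely a shorter one in
  \<open>u\<close> is completed by \<open>m\<close>. Bounding only \<open>butlast u\<close> covers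
  the \<open>only_inversion\<close> case as well.\<close>

lemma descent_rise_insert_max_iff:
  assumes "\<forall>z\<in>set u \<union> set v. z < m" "\<forall>x\<in>set (butlast u). \<forall>y\<in>set v. y < x"
  shows "descent_rise (Suc r) (u @ m # v) \<longleftrightarrow> descent_rise r u \<or> descent_rise (Suc r) v"
proof
  assume "descent_rise (Suc r) (u @ m # v)"
  then obtain p a b q s where *: "u @ m # v = p @ a # b # q" "b < a" "subseq s q"
      "\<forall>z\<in>set s. a < z" "sorted_wrt (<) s" "length s = Suc r" by (auto simp: descent_rise_def)
  have sq: "set s \<subseteq> set q" using *(3) by (rule subseq_set_subset)
  from *(1) obtain t where "u = p @ t \<and> t @ m # v = a # b # q \<or> u @ t = p \<and> m # v = t @ a # b # q"
    by (auto simp: append_eq_append_conv2)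
  \<comment> \<open>The descent starts at \<open>m\<close>, ends at \<open>m\<close>, or lies
    entirely in \<open>u\<close> or in \<open>v\<close>.\<close>
  then consider "u = p" "a = m" "v = b # q"
    | "u = p @ [a]" "b = m"
    | t' where "u = p @ a # b # t'" "q = t' @ m # v"
    | t' where "v = t' @ a # b # q"
    by (auto simp: Cons_eq_append_conv append_eq_Cons_conv)
  thus "descent_rise r u \<or> descent_rise (Suc r) v"
  proof cases
    case 1
    obtain z where "z \<in> set s" using *(6) by (cases s) auto
    hence "m < z" "z < m" using 1 sq *(4) assms(1) by auto
    thus ?thesis by simp
  next
    case 2
    thus ?thesis using *(2) assms(1) by auto
  next
    case 3
    \<comment> \<open>Being followed by \<open>b\<close> inside \<open>u\<close>, the letter
      \<open>a\<close> exceeds all of \<open>v\<close>; beyond \<open>u\<close> the rise can only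
      use \<open>m\<close>.\<close>
    have av: "\<forall>y\<in>set v. y < a" using assms(2) 3 by (simp add: butlast_append)
    from *(3) 3 obtain s1 s2 where s: "s = s1 @ s2" "subseq s1 t'" "subseq s2 (m # v)"
      by (auto simp: subseq_append_iff)
    have "set s2 \<subseteq> {m}"
      using subseq_set_subset[OF s(3)] *(4) av s(1) by (auto dest: less_asym)
    moreover have "distinct s2"
      using *(5) s(1) by (auto simp: sorted_wrt_append strict_sorted_iff)
    ultimately have "length s2 \<le> 1"
      by (metis card_mono distinct_card finite.emptyI finite_insert is_singletonI is_singleton_altdef)
    hence len: "r \<le> length s1" using *(6) s(1) by simp
    have "subseq (take r s1) t'"
      using s(2) by (meson prefix_imp_subseq subseq_order.trans take_is_prefix)
    moreover have "sorted_wrt (<) (a # take r s1)"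
      using *(4,5) s(1) by (auto simp: sorted_wrt_append sorted_wrt_take dest: in_set_takeD)
    ultimately have "descent_rise r u" unfolding descent_rise_def
      using 3 *(2) len by (intro exI[of _ p] exI[of _ a] exI[of _ b] exI[of _ t'] exI[of _ "take r s1"]) auto
    thus ?thesis ..
  next
    case 4
    have "sorted_wrt (<) (a # s)" using *(4,5) by simp
    hence "descent_rise (Suc r) v" unfolding descent_rise_def using 4 * by blast
    thus ?thesis ..
  qed
next
  assume "descent_rise r u \<or> descent_rise (Suc r) v"
  thus "descent_rise (Suc r) (u @ m # v)"
  proof
    assume "descent_rise r u"
    then obtain p a b q s where *: "u = p @ a # b # q" "b < a" "subseq s q"
      "sorted_wrt (<) (a # s)" "length s = r" unfolding descent_rise_def by blast
    have "set s \<subseteq> set q" using *(3) by (rule subseq_set_subset)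
    hence "sorted_wrt (<) (a # (s @ [m]))"
      using * assms(1) by (auto simp: sorted_wrt_append)
    moreover have "subseq (s @ [m]) (q @ m # v)"
      using *(3) by (intro list_emb_append_mono) auto
    ultimately show ?thesis unfolding descent_rise_def
      using * by (intro exI[of _ p] exI[of _ a] exI[of _ b] exI[of _ "q @ m # v"] exI[of _ "s @ [m]"]) auto
  next
    assume "descent_rise (Suc r) v"
    thus ?thesis unfolding descent_rise_def by (metis append.assoc append_Cons)
  qed
qed

text \<open>As the rise is nonempty, \<open>c\<close> comes after the descent, and it is too small
  to belong to the rise.\<close>

lemma descent_rise_Suc_snoc_min_iff:
  assumes "\<forall>x\<in>set u. c < x"
  shows "descent_rise (Suc r) (u @ [c]) \<longleftrightarrow> descent_rise (Suc r) u"
proof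
  assume "descent_rise (Suc r) (u @ [c])"
  then obtain p a b q s where *: "u @ [c] = p @ a # b # q" "b < a" "subseq s q"
      "sorted_wrt (<) (a # s)" "length s = Suc r" by (auto simp: descent_rise_def)
  have "q \<noteq> []" using * by auto
  then obtain q' where q: "q = q' @ [c]" "u = p @ a # b # q'"
    using *(1) by (cases q rule: rev_cases) auto
  have "c \<notin> set s" using *(4) q(2) assms by auto
  from *(3) obtain s1 s2 where s: "s = s1 @ s2" "subseq s1 q'" "subseq s2 [c]"
    by (auto simp: q subseq_append_iff)
  have "s2 = []" using subseq_set_subset[OF s(3)] s(1) \<open>c \<notin> set s\<close> by (cases s2) auto
  hence "subseq s q'" using s by simp
  thus "descent_rise (Suc r) u" using q(2) *(2,4,5) unfolding descent_rise_def by blast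
next
  assume "descent_rise (Suc r) u"
  then obtain p a b q s where *: "u = p @ a # b # q" "b < a" "subseq s q"
      "sorted_wrt (<) (a # s)" "length s = Suc r" unfolding descent_rise_def by blast
  have "subseq s (q @ [c])" using *(3) by (rule subseq_rev_drop_many)
  thus "descent_rise (Suc r) (u @ [c])" unfolding descent_rise_def using *
    by (intro exI[of _ p] exI[of _ a] exI[of _ b] exI[of _ "q @ [c]"] exI[of _ s]) auto
qed

lemma descent_rise_0_iff: "descent_rise 0 w \<longleftrightarrow> \<not> sorted w"
proof -
  have "descent_rise 0 w \<longleftrightarrow> (\<exists>i. Suc i < length w \<and> w ! Suc i < w ! i)"
  proof
    assume "descent_rise 0 w"
    then obtain p a b q where "w = p @ a # b # q" "b < a" by (auto simp: descent_rise_def)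
    thus "\<exists>i. Suc i < length w \<and> w ! Suc i < w ! i"
      by (intro exI[of _ "length p"]) (auto simp: nth_append)
  next
    assume "\<exists>i. Suc i < length w \<and> w ! Suc i < w ! i"
    then obtain i where i: "Suc i < length w" "w ! Suc i < w ! i" by blast
    have "w = take i w @ w ! i # w ! Suc i # drop (Suc (Suc i)) w"
      using i(1) by (simp add: Cons_nth_drop_Suc)
    thus "descent_rise 0 w" using i(2) unfolding descent_rise_def by fastforce
  qed
  thus ?thesis by (auto simp: sorted_iff_nth_Suc not_le)
qed

lemma descent_rise_0_snoc_min_iff:
  assumes "\<forall>x\<in>set u. c < x"
  shows "descent_rise 0 (u @ [c]) \<longleftrightarrow> u \<noteq> []"
proof (cases u)
  case (Cons x u')
  hence "c < x" using assms by simp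
  hence "\<not> sorted (u @ [c])" by (simp add: Cons sorted_append)
  thus ?thesis by (simp add: descent_rise_0_iff Cons)
qed (simp add: descent_rise_0_iff)

section \<open>Counting recurrences\<close>

lemma occurrences_map_strict_mono:
  assumes "strict_mono_on (set w) f"
  shows "occurrences p (map f w) = occurrences p w"
proof -
  have "order_isomorphic (map (nth (map f w)) ns) \<tau> \<longleftrightarrow> order_isomorphic (map (nth w) ns) \<tau>"
    if "set ns \<subseteq> {..<length w}" for ns \<tau>
  proof -
    have "f (w ! (ns ! i)) < f (w ! (ns ! j)) \<longleftrightarrow> w ! (ns ! i) < w ! (ns ! j)"
      if "i < length ns" "j < length ns" for i j
      using assms that \<open>set ns \<subseteq> {..<length w}\<close>
      by (intro strict_mono_on_less) (auto dest!: nth_mem)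
    moreover have "ns ! i < length w" if "i < length ns" for i
      using that \<open>set ns \<subseteq> {..<length w}\<close> by (auto dest!: nth_mem)
    ultimately show ?thesis by (simp add: order_isomorphic_def)
  qed
  thus ?thesis by (cases p) (auto simp: occurrences_def)
qed

lemma num132_map_strict_mono:
  "strict_mono_on (set w) f \<Longrightarrow> num132 (map f w) = num132 w"
  by (simp flip: card_occurrences_132 add: occurrences_map_strict_mono)

lemma descent_rise_map_strict_mono:
  "strict_mono_on (set w) f \<Longrightarrow> descent_rise r (map f w) \<longleftrightarrow> descent_rise r w"
  using avoids_21_3_to_iff[of w r] avoids_21_3_to_iff[of "map f w" r]
  by (simp add: avoids_def occurrences_map_strict_mono)

text \<open>Each set of letters is relabelled by its increasing bijection with an initial segment,
  under which \<open>P\<close> is unchanged; so the count depends on the size only.\<close>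

lemma card_permutations_pattern_cong:
  fixes A B :: "nat set"
  assumes "finite A" "finite B" "card A = card B"
    and P: "\<And>f w. strict_mono_on (set w) f \<Longrightarrow> P (map f w) \<longleftrightarrow> P w"
  shows "card {w \<in> permutations_of_set A. P w} = card {w \<in> permutations_of_set B. P w}"
proof -
  have *: "card {w \<in> permutations_of_set M. P w} = card {w \<in> permutations_of_set {..<card M}. P w}"
    if "finite M" for M :: "nat set"
  proof -
    obtain g where g: "bij_betw g {..<card M} M" "strict_mono_on {..<card M} g"
      by (rule ex_bij_betw_strict_mono_card[OF \<open>finite M\<close>])
    have inj: "inj_on g {..<card M}" and M: "M = g ` {..<card M}"
      using g(1) by (auto simp: bij_betw_def)
    have "permutations_of_set M = map g ` permutations_of_set {..<card M}"
      by (subst M) (rule permutations_of_set_image_inj[OF inj])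
    hence "{w \<in> permutations_of_set M. P w} = map g ` {w \<in> permutations_of_set {..<card M}. P w}"
      using P g(2) by (auto simp: permutations_of_set_def)
    moreover have "inj_on (map g) {w \<in> permutations_of_set {..<card M}. P w}"
      by (rule inj_on_subset[OF inj_on_mapI[of g "permutations_of_set {..<card M}"]])
         (use inj in \<open>auto simp: permutations_of_set_def intro: inj_on_subset\<close>)
    ultimately show ?thesis by (simp add: card_image)
  qed
  show ?thesis using *[OF assms(1)] *[OF assms(2)] assms(3) by simp
qed

section \<open>The counted classes, and joining words at the maximum\<close>

definition Av :: "nat \<Rightarrow> nat set \<Rightarrow> nat list set" where
  "Av r A = {w \<in> permutations_of_set A. num132 w = 0 \<and> \<not> descent_rise r w}"

definition Once :: "nat \<Rightarrow> nat set \<Rightarrow> nat list set" where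
  "Once r A = {w \<in> permutations_of_set A. num132 w = 1 \<and> \<not> descent_rise r w}"

text \<open>
  The words that still avoid both patterns after a new minimum is appended. For \<open>r = 0\<close> the
  pattern is \<open>21\<close>, which the new letter completes unless the word was empty.
\<close>

definition Av_snoc :: "nat \<Rightarrow> nat set \<Rightarrow> nat list set" where
  "Av_snoc r A = {w \<in> permutations_of_set A. num132 w = 0 \<and> (if r = 0 then w = [] else \<not> descent_rise r w)}"

lemma finite_Av [simp]: "finite (Av r A)" and finite_Once [simp]: "finite (Once r A)"
  and finite_Av_snoc [simp]: "finite (Av_snoc r A)"
  by (simp_all add: Av_def Once_def Av_snoc_def)

lemma card_Av_cong: "finite A \<Longrightarrow> card (Av r A) = card (Av r {1..card A})"
  unfolding Av_def by (rule card_permutations_pattern_cong)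
    (auto simp: num132_map_strict_mono descent_rise_map_strict_mono)

lemma card_Once_cong: "finite A \<Longrightarrow> card (Once r A) = card (Once r {1..card A})"
  unfolding Once_def by (rule card_permutations_pattern_cong)
    (auto simp: num132_map_strict_mono descent_rise_map_strict_mono)

lemma card_Av_snoc_cong: "finite A \<Longrightarrow> card (Av_snoc r A) = card (Av_snoc r {1..card A})"
  unfolding Av_snoc_def by (rule card_permutations_pattern_cong)
    (auto simp: num132_map_strict_mono descent_rise_map_strict_mono)

lemma AvD: "w \<in> Av r A \<Longrightarrow> set w = A \<and> distinct w \<and> num132 w = 0 \<and> \<not> descent_rise r w"
  and OnceD: "w \<in> Once r A \<Longrightarrow> set w = A \<and> distinct w \<and> num132 w = 1 \<and> \<not> descent_rise r w"
  and Av_snocD: "w \<in> Av_snoc r A \<Longrightarrow> set w = A \<and> distinct w \<and> num132 w = 0"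
  by (auto simp: Av_def Once_def Av_snoc_def permutations_of_set_def)

lemma AvI: "set w = A \<Longrightarrow> distinct w \<Longrightarrow> num132 w = 0 \<Longrightarrow> \<not> descent_rise r w \<Longrightarrow> w \<in> Av r A"
  and OnceI: "set w = A \<Longrightarrow> distinct w \<Longrightarrow> num132 w = 1 \<Longrightarrow> \<not> descent_rise r w \<Longrightarrow> w \<in> Once r A"
  by (simp_all add: Av_def Once_def permutations_of_set_def)

lemma Av_snoc_iff:
  assumes "\<forall>x\<in>set s. a < x"
  shows "s \<in> Av_snoc r A \<longleftrightarrow> set s = A \<and> distinct s \<and> num132 s = 0 \<and> \<not> descent_rise r (s @ [a])"
  using descent_rise_0_snoc_min_iff[OF assms] descent_rise_Suc_snoc_min_iff[OF assms]
  by (cases r) (auto simp: Av_snoc_def permutations_of_set_def)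

definition joins :: "nat \<Rightarrow> nat set \<Rightarrow> (nat \<Rightarrow> nat list set) \<Rightarrow> (nat \<Rightarrow> nat list set) \<Rightarrow> nat list set" where
  "joins m I X Y = (\<Union>i\<in>I. {u @ m # v |u v. u \<in> X i \<and> v \<in> Y i})"

lemma joinsI: "i \<in> I \<Longrightarrow> u \<in> X i \<Longrightarrow> v \<in> Y i \<Longrightarrow> u @ m # v \<in> joins m I X Y"
  unfolding joins_def by blast

lemma append_Cons_notin_eq_iff:
  assumes "m \<notin> set u" "m \<notin> set u'"
  shows "u @ m # v = u' @ m # v' \<longleftrightarrow> u = u' \<and> v = v'"
  using assms by (auto simp: append_eq_append_conv2 append_eq_Cons_conv Cons_eq_append_conv)

text \<open>Cutting a joined word at its first \<open>m\<close> recovers \<open>u\<close> and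
  \<open>v\<close>, and then \<open>i = length v\<close>. So the union is disjoint and every word
  arises once.\<close>

lemma card_joins:
  assumes "finite I" "\<And>i. i \<in> I \<Longrightarrow> finite (X i)" "\<And>i. i \<in> I \<Longrightarrow> finite (Y i)"
    and "\<And>i u. i \<in> I \<Longrightarrow> u \<in> X i \<Longrightarrow> m \<notin> set u"
    and "\<And>i v. i \<in> I \<Longrightarrow> v \<in> Y i \<Longrightarrow> m \<notin> set v \<and> length v = i"
  shows "finite (joins m I X Y)" "card (joins m I X Y) = (\<Sum>i\<in>I. card (Y i) * card (X i))"
proof -
  let ?S = "SIGMA i:I. Y i \<times> X i"
  have eq: "joins m I X Y = (\<lambda>(i, v, u). u @ m # v) ` ?S"
    by (force simp: joins_def)
  have "inj_on (\<lambda>(i, v, u). u @ m # v) ?S"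
  proof (rule inj_onI)
    fix p p' assume pS: "p \<in> ?S" "p' \<in> ?S"
      and eq': "(\<lambda>(i, v, u). u @ m # v) p = (\<lambda>(i, v, u). u @ m # v) p'"
    obtain i u v i' u' v' where p: "p = (i, v, u)" "p' = (i', v', u')" by (metis prod_cases3)
    have i: "i \<in> I" "v \<in> Y i" "u \<in> X i" and i': "i' \<in> I" "v' \<in> Y i'" "u' \<in> X i'"
      and eq: "u @ m # v = u' @ m # v'" using pS eq' by (auto simp: p)
    have "u = u' \<and> v = v'" using append_Cons_notin_eq_iff[OF assms(4)[OF i(1,3)] assms(4)[OF i'(1,3)]] eq by simp
    moreover have "i = i'" using assms(5)[OF i(1,2)] assms(5)[OF i'(1,2)] calculation by simp
    ultimately show "p = p'" by (simp add: p)
  qed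
  thus "card (joins m I X Y) = (\<Sum>i\<in>I. card (Y i) * card (X i))"
    using assms(1-3) by (simp add: eq card_image card_SigmaI card_cartesian_product)
  show "finite (joins m I X Y)"
    using assms(1-3) by (auto simp: eq)
qed

section \<open>Letter sets on the two sides of the maximum\<close>

lemma permutation_Suc_split:
  "w \<in> permutations_of_set {1..Suc n} \<longleftrightarrow>
     (\<exists>u v. w = u @ Suc n # v \<and> distinct u \<and> distinct v \<and> set u \<inter> set v = {} \<and> set u \<union> set v = {1..n})"
proof
  assume w: "w \<in> permutations_of_set {1..Suc n}"
  hence "Suc n \<in> set w" by (auto simp: permutations_of_set_def)
  then obtain u v where uv: "w = u @ Suc n # v" by (meson split_list)
  moreover have "set u \<union> set v = {1..Suc n} - {Suc n}"
    using w uv by (auto simp: permutations_of_set_def)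
  moreover have "{1..Suc n} - {Suc n} = {1..n}" by auto
  ultimately show "\<exists>u v. w = u @ Suc n # v \<and> distinct u \<and> distinct v \<and> set u \<inter> set v = {} \<and> set u \<union> set v = {1..n}"
    using w by (auto simp: permutations_of_set_def)
next
  assume "\<exists>u v. w = u @ Suc n # v \<and> distinct u \<and> distinct v \<and> set u \<inter> set v = {} \<and> set u \<union> set v = {1..n}"
  then obtain u v where *: "w = u @ Suc n # v" "distinct u" "distinct v" "set u \<inter> set v = {}"
    "set u \<union> set v = {1..n}" by blast
  moreover have "Suc n \<notin> set u \<union> set v" unfolding *(5) by simp
  hence "Suc n \<notin> set u" "Suc n \<notin> set v" by blast+
  moreover have "set w = insert (Suc n) {1..n}" unfolding *(5)[symmetric] by (auto simp: *(1))
  moreover have "insert (Suc n) {1..n} = {1..Suc n}" by auto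
  ultimately show "w \<in> permutations_of_set {1..Suc n}"
    by (intro permutations_of_setI) simp_all
qed

text \<open>The cut is at the largest element of \<open>V\<close>, or at 0 if \<open>V\<close> is
  empty: a smaller number outside \<open>V\<close> would be an element of \<open>U\<close> below
  it.\<close>

lemma separated_intervals:
  fixes U V :: "nat set"
  assumes "U \<union> V = {1..n}" "\<forall>x\<in>U. \<forall>y\<in>V. y < x"
  shows "\<exists>i\<le>n. V = {1..i} \<and> U = {i+1..n}"
proof (cases "V = {}")
  case True
  thus ?thesis using assms(1) by (intro exI[of _ 0]) auto
next
  case False
  have fin: "finite V" using assms(1) by (metis finite_Un finite_atLeastAtMost)
  define i where "i = Max V"
  have i: "i \<in> V" "\<forall>y\<in>V. y \<le> i" using fin False by (auto simp: i_def)
  have "i \<le> n" using i(1) assms(1) by auto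
  have V: "V = {1..i}"
  proof (intro equalityI subsetI)
    fix y assume "y \<in> V" thus "y \<in> {1..i}" using i assms(1) by auto
  next
    fix y assume y: "y \<in> {1..i}"
    hence "y \<in> U \<union> V" using \<open>i \<le> n\<close> assms(1) by auto
    thus "y \<in> V" using assms(2) i(1) y by fastforce
  qed
  have "U = {i+1..n}"
  proof (intro equalityI subsetI)
    fix x assume x: "x \<in> U"
    hence "i < x" using assms(2) i(1) by blast
    thus "x \<in> {i+1..n}" using x assms(1) by auto
  next
    fix x assume x: "x \<in> {i+1..n}"
    hence "x \<in> U \<union> V" using assms(1) by auto
    thus "x \<in> U" using x i(2) by auto
  qed
  thus ?thesis using V \<open>i \<le> n\<close> by blast
qed

text \<open>Exchanging \<open>a\<close> and \<open>b\<close> between the two sides restores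
  separation, so \<open>separated_intervals\<close> applies. Then \<open>a\<close> is the top of the
  lower interval and \<open>b\<close> the bottom of the upper one.\<close>

lemma only_inversion_intervals:
  assumes "set (s @ [a]) \<union> set v = {1..n}" "set (s @ [a]) \<inter> set v = {}" "distinct (s @ [a])"
    "only_inversion s v a b"
  shows "a \<in> {1..<n} \<and> b = Suc a \<and> set s = {a + 2..n} \<and> set v = {1..<a} \<union> {Suc a}"
proof -
  note o = assms(4)[unfolded only_inversion_def]
  have "\<exists>i\<le>n. insert a (set v - {b}) = {1..i} \<and> insert b (set s) = {i+1..n}"
  proof (rule separated_intervals)
    show "insert b (set s) \<union> insert a (set v - {b}) = {1..n}"
      using assms(1) o by auto
    show "\<forall>x\<in>insert b (set s). \<forall>y\<in>insert a (set v - {b}). y < x"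
      using o by (metis DiffD1 insert_iff less_trans)
  qed
  then obtain i where i: "i \<le> n" "insert a (set v - {b}) = {1..i}" "insert b (set s) = {i+1..n}"
    by blast
  have a: "a = i"
  proof -
    have "a \<in> {1..i}" using i(2) by blast
    moreover have "i \<in> {1..i}" using calculation by auto
    hence "i \<in> insert a (set v - {b})" using i(2) by simp
    hence "i \<le> a" using o by (auto intro: less_imp_le)
    ultimately show ?thesis by simp
  qed
  have b: "b = Suc i"
  proof -
    have "b \<in> {i+1..n}" using i(3) by blast
    moreover have "Suc i \<in> {i+1..n}" using calculation by auto
    hence "Suc i \<in> insert b (set s)" using i(3) by simp
    hence "b \<le> Suc i" using o by (auto intro: less_imp_le)
    ultimately show ?thesis by simp
  qed
  have "b \<notin> set s" using o by auto
  hence s: "set s = {i+1..n} - {b}" using i(3) by auto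
  have "a \<notin> set v" using assms(2) by auto
  hence "set v - {b} = {1..i} - {a}" using i(2) by auto
  moreover have "set v = insert b (set v - {b})" using o by auto
  ultimately have v: "set v = insert b ({1..i} - {a})" by simp
  have "b \<in> {i+1..n}" "a \<in> {1..i}" using i by blast+
  thus ?thesis unfolding s v using a b by auto
qed

text \<open>The left word must avoid the pattern with a rise shorter by one, because the maximum
  would complete it; separation makes both letter sets intervals.\<close>

lemma Av_Suc_decomposition:
  "Av (Suc r) {1..Suc n} = joins (Suc n) {..n} (\<lambda>i. Av r {i+1..n}) (\<lambda>i. Av (Suc r) {1..i})"
proof (intro equalityI subsetI)
  fix w assume w: "w \<in> Av (Suc r) {1..Suc n}"
  then obtain u v where uv: "w = u @ Suc n # v" "distinct u" "distinct v" "set u \<inter> set v = {}"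
    "set u \<union> set v = {1..n}"
    using permutation_Suc_split by (auto simp: Av_def)
  have max: "\<forall>z\<in>set u \<union> set v. z < Suc n" unfolding uv by auto
  have *: "num132 u = 0" "num132 v = 0" "\<forall>x\<in>set u. \<forall>y\<in>set v. y < x"
    using num132_insert_max_eq_0_iff[OF max uv(4)] w uv(1) by (auto simp: Av_def)
  have "\<forall>x\<in>set (butlast u). \<forall>y\<in>set v. y < x" using *(3) by (blast dest: in_set_butlastD)
  hence "\<not> descent_rise r u \<and> \<not> descent_rise (Suc r) v"
    using descent_rise_insert_max_iff[OF max, of r] w uv(1) by (simp add: Av_def)
  moreover obtain i where "i \<le> n" "set v = {1..i}" "set u = {i+1..n}"
    using separated_intervals[OF uv(5) *(3)] by blast
  ultimately show "w \<in> joins (Suc n) {..n} (\<lambda>i. Av r {i+1..n}) (\<lambda>i. Av (Suc r) {1..i})"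
    unfolding uv(1) using uv(2,3) * by (intro joinsI[of i]) (simp_all add: AvI)
next
  fix w assume "w \<in> joins (Suc n) {..n} (\<lambda>i. Av r {i+1..n}) (\<lambda>i. Av (Suc r) {1..i})"
  then obtain i u v where i: "i \<le> n" and w: "w = u @ Suc n # v" and "u \<in> Av r {i+1..n}" "v \<in> Av (Suc r) {1..i}"
    by (auto simp: joins_def)
  note u = AvD[OF this(3)] and v = AvD[OF this(4)]
  have un: "set u \<union> set v = {1..n}" "set u \<inter> set v = {}" using u v i by auto
  have max: "\<forall>z\<in>set u \<union> set v. z < Suc n" unfolding un by auto
  have sep: "\<forall>x\<in>set u. \<forall>y\<in>set v. y < x" using u v by auto
  hence sep': "\<forall>x\<in>set (butlast u). \<forall>y\<in>set v. y < x" by (blast dest: in_set_butlastD)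
  have "num132 w = 0" using num132_insert_max_eq_0_iff[OF max un(2)] sep u v by (simp add: w)
  moreover have "\<not> descent_rise (Suc r) w"
    using descent_rise_insert_max_iff[OF max sep', of r] u v by (simp add: w)
  moreover have "w \<in> permutations_of_set {1..Suc n}"
    using permutation_Suc_split w un u v by blast
  ultimately show "w \<in> Av (Suc r) {1..Suc n}" by (simp add: Av_def)
qed

text \<open>The single occurrence lies in the left word, lies in the right word, or consists of
  \<open>i\<close>, the maximum and \<open>i + 1\<close>; in the last case \<open>i\<close> ends the
  left word.\<close>

lemma Once_Suc_decomposition:
  "Once (Suc r) {1..Suc n} =
     joins (Suc n) {..n} (\<lambda>i. Once r {i+1..n}) (\<lambda>i. Av (Suc r) {1..i}) \<union>
     joins (Suc n) {..n} (\<lambda>i. Av r {i+1..n}) (\<lambda>i. Once (Suc r) {1..i}) \<union>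
     joins (Suc n) {1..<n} (\<lambda>i. (\<lambda>s. s @ [i]) ` Av_snoc r {i+2..n})
       (\<lambda>i. Av (Suc r) ({1..<i} \<union> {Suc i}))"
  (is "_ = ?A \<union> ?B \<union> ?C")
proof (intro equalityI subsetI)
  fix w assume w: "w \<in> Once (Suc r) {1..Suc n}"
  then obtain u v where uv: "w = u @ Suc n # v" "distinct u" "distinct v" "set u \<inter> set v = {}"
    "set u \<union> set v = {1..n}"
    using permutation_Suc_split by (auto simp: Once_def)
  have max: "\<forall>z\<in>set u \<union> set v. z < Suc n" unfolding uv by auto
  consider "num132 u + num132 v = 1" "\<forall>x\<in>set u. \<forall>y\<in>set v. y < x"
    | s a b where "u = s @ [a]" "only_inversion s v a b" "num132 s = 0" "num132 v = 0"
    using num132_insert_max_eq_1_iff[OF max uv(4,3)] w uv(1) by (auto simp: Once_def)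
  thus "w \<in> ?A \<union> ?B \<union> ?C"
  proof cases
    case 1
    have "\<forall>x\<in>set (butlast u). \<forall>y\<in>set v. y < x" using 1(2) by (blast dest: in_set_butlastD)
    hence "\<not> descent_rise r u \<and> \<not> descent_rise (Suc r) v"
      using descent_rise_insert_max_iff[OF max, of r] w uv(1) by (simp add: Once_def)
    moreover obtain i where "i \<le> n" "set v = {1..i}" "set u = {i+1..n}"
      using separated_intervals[OF uv(5) 1(2)] by blast
    moreover have "num132 u = 1 \<and> num132 v = 0 \<or> num132 u = 0 \<and> num132 v = 1"
      using 1(1) by linarith
    ultimately have "w \<in> ?A \<or> w \<in> ?B"
      unfolding uv(1) using uv(2,3)
      by (elim disjE) (intro disjI1 joinsI[of i], simp_all add: AvI OnceI,
                       intro disjI2 joinsI[of i], simp_all add: AvI OnceI)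
    thus ?thesis by blast
  next
    case 2
    have sep: "\<forall>x\<in>set (butlast u). \<forall>y\<in>set v. y < x"
      using 2 by (simp add: only_inversion_def)
    have dr: "\<not> descent_rise r (s @ [a])" "\<not> descent_rise (Suc r) v"
      using descent_rise_insert_max_iff[OF max sep, of r] 2(1) w uv(1) by (auto simp: Once_def)
    have iv: "a \<in> {1..<n}" "b = Suc a" "set s = {a + 2..n}" "set v = {1..<a} \<union> {Suc a}"
      using only_inversion_intervals[of s a v n b] uv 2 by auto
    have "\<forall>x\<in>set s. a < x" unfolding iv by auto
    hence "s \<in> Av_snoc r {a + 2..n}"
      using iv(3) uv(2) 2(1,3) dr(1) Av_snoc_iff[of s a r "{a + 2..n}"] by simp
    moreover have "v \<in> Av (Suc r) ({1..<a} \<union> {Suc a})"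
      using uv(3) iv(4) 2(4) dr(2) by (simp add: Av_def permutations_of_set_def)
    ultimately have "w \<in> ?C" unfolding uv(1) 2(1) using iv(1) by (intro joinsI[of a]) simp_all
    thus ?thesis by blast
  qed
next
  fix w assume "w \<in> ?A \<union> ?B \<union> ?C"
  then consider "w \<in> ?A \<union> ?B" | "w \<in> ?C" by blast
  thus "w \<in> Once (Suc r) {1..Suc n}"
  proof cases
    case 1
    then obtain i u v where i: "i \<le> n" and w: "w = u @ Suc n # v"
      and uv: "u \<in> Once r {i+1..n} \<and> v \<in> Av (Suc r) {1..i} \<or> u \<in> Av r {i+1..n} \<and> v \<in> Once (Suc r) {1..i}"
      unfolding joins_def by blast
    from uv have u: "set u = {i+1..n} \<and> distinct u \<and> \<not> descent_rise r u"
      and v: "set v = {1..i} \<and> distinct v \<and> \<not> descent_rise (Suc r) v"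
      and c: "num132 u + num132 v = 1"
      by (auto dest!: AvD OnceD)
    have un: "set u \<union> set v = {1..n}" "set u \<inter> set v = {}" using u v i by auto
    have max: "\<forall>z\<in>set u \<union> set v. z < Suc n" unfolding un by auto
    have sep: "\<forall>x\<in>set u. \<forall>y\<in>set v. y < x" using u v by auto
  hence sep': "\<forall>x\<in>set (butlast u). \<forall>y\<in>set v. y < x" by (blast dest: in_set_butlastD)
    have "num132 w = 1" using num132_insert_max_separated[OF max sep] c by (simp add: w)
    moreover have "\<not> descent_rise (Suc r) w"
      using descent_rise_insert_max_iff[OF max sep', of r] u v by (simp add: w)
    moreover have "w \<in> permutations_of_set {1..Suc n}"
      using permutation_Suc_split w un u v by blast
    ultimately show ?thesis by (simp add: Once_def)
  next
    case 2
    then obtain i s v where i: "i \<in> {1..<n}" and w: "w = (s @ [i]) @ Suc n # v"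
      and s': "s \<in> Av_snoc r {i + 2..n}" and v': "v \<in> Av (Suc r) ({1..<i} \<union> {Suc i})"
      unfolding joins_def by blast
    note s = Av_snocD[OF s'] and v = AvD[OF v']
    have "\<forall>x\<in>set s. i < x" using s by auto
    hence dr: "\<not> descent_rise r (s @ [i])" using Av_snoc_iff s' by blast
    have un: "set (s @ [i]) \<union> set v = {1..n}" "set (s @ [i]) \<inter> set v = {}" using s v i by auto
    have max: "\<forall>z\<in>set (s @ [i]) \<union> set v. z < Suc n" unfolding un by auto
    have o: "only_inversion s v i (Suc i)"
      using s v by (auto simp: only_inversion_def)
    have "num132 w = 1"
      using num132_only_inversion[OF max _ o] s v by (simp add: w)
    moreover have "\<not> descent_rise (Suc r) w"
      unfolding w using descent_rise_insert_max_iff[OF max, of r] dr v o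
      by (simp add: only_inversion_def)
    moreover have "distinct (s @ [i])" using s by auto
    hence "w \<in> permutations_of_set {1..Suc n}"
      using permutation_Suc_split w un v by blast
    ultimately show ?thesis by (simp add: Once_def)
  qed
qed

section \<open>Recurrences for the counts\<close>

definition av :: "nat \<Rightarrow> nat \<Rightarrow> nat" where "av r n = card (Av r {1..n})"
definition once :: "nat \<Rightarrow> nat \<Rightarrow> nat" where "once r n = card (Once r {1..n})"
definition av_snoc :: "nat \<Rightarrow> nat \<Rightarrow> nat" where "av_snoc r n = card (Av_snoc r {1..n})"

lemma length_eq_card_set: "distinct v \<Longrightarrow> set v = A \<Longrightarrow> length v = card A"
  using distinct_card by force

lemma av_Suc_Suc: "av (Suc r) (Suc n) = (\<Sum>i\<le>n. av (Suc r) i * av r (n - i))"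
proof -
  have "av (Suc r) (Suc n) = (\<Sum>i\<le>n. card (Av (Suc r) {1..i}) * card (Av r {i+1..n}))"
    unfolding av_def Av_Suc_decomposition
    by (rule card_joins) (auto dest!: AvD length_eq_card_set)
  also have "\<dots> = (\<Sum>i\<le>n. av (Suc r) i * av r (n - i))"
    by (rule sum.cong) (use card_Av_cong[of "{_+1..n}" r] in \<open>auto simp: av_def\<close>)
  finally show ?thesis .
qed

lemma once_Suc_Suc:
  "once (Suc r) (Suc n) = (\<Sum>i\<le>n. av (Suc r) i * once r (n - i)) +
     (\<Sum>i\<le>n. once (Suc r) i * av r (n - i)) +
     (\<Sum>i = 1..<n. av (Suc r) i * av_snoc r (n - 1 - i))"
proof -
  define X1 Y1 X2 Y2 X3 Y3 where
    "X1 = (\<lambda>i. Once r {i+1..n})" and "Y1 = (\<lambda>i. Av (Suc r) {1..i})" and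
    "X2 = (\<lambda>i. Av r {i+1..n})" and "Y2 = (\<lambda>i. Once (Suc r) {1..i})" and
    "X3 = (\<lambda>i. (\<lambda>s. s @ [i]) ` Av_snoc r {i+2..n})" and
    "Y3 = (\<lambda>i. Av (Suc r) ({1..<i} \<union> {Suc i}))"
  note defs = X1_def Y1_def X2_def Y2_def X3_def Y3_def
  let ?m = "Suc n"
  have J1: "finite (joins ?m {..n} X1 Y1)" "card (joins ?m {..n} X1 Y1) = (\<Sum>i\<le>n. card (Y1 i) * card (X1 i))"
    by (rule card_joins; auto simp: defs dest!: AvD OnceD length_eq_card_set)+
  have J2: "finite (joins ?m {..n} X2 Y2)" "card (joins ?m {..n} X2 Y2) = (\<Sum>i\<le>n. card (Y2 i) * card (X2 i))"
    by (rule card_joins; auto simp: defs dest!: AvD OnceD length_eq_card_set)+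
  \<comment> \<open>Replacing \<open>i\<close> by \<open>Suc i\<close> keeps the size
    \<open>i\<close>, so the right-hand word still has its index as length, as
    \<open>card_joins\<close> demands.\<close>
  have cd: "card ({1..<i} \<union> {Suc i}) = i" if "1 \<le> i" for i :: nat
    using that by (subst card_Un_disjoint) auto
  have Y3: "?m \<notin> set v \<and> length v = i" if "i \<in> {1..<n}" "v \<in> Y3 i" for i v
  proof -
    have "set v = {1..<i} \<union> {Suc i}" "distinct v" using that(2) AvD unfolding Y3_def by blast+
    thus ?thesis using that(1) cd[of i] length_eq_card_set[of v] by auto
  qed
  have X3: "?m \<notin> set u" if "i \<in> {1..<n}" "u \<in> X3 i" for i u
    using that by (auto simp: X3_def dest!: Av_snocD)
  have J3: "finite (joins ?m {1..<n} X3 Y3)"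
    "card (joins ?m {1..<n} X3 Y3) = (\<Sum>i = 1..<n. card (Y3 i) * card (X3 i))"
    by (rule card_joins; use X3 Y3 in \<open>auto simp: X3_def Y3_def\<close>)+
  have uniq: "u = u' \<and> v = v'"
    if "u @ ?m # v = u' @ ?m # v'" "?m \<notin> set u" "?m \<notin> set u'" for u u' v v'
    using that by (simp add: append_Cons_notin_eq_iff)
  \<comment> \<open>A common word would have a left part with both one occurrence of 1-3-2 and
    none.\<close>
  have D12: "joins ?m {..n} X1 Y1 \<inter> joins ?m {..n} X2 Y2 = {}"
  proof -
    have False if "i \<le> n" "j \<le> n" "u \<in> X1 i" "v \<in> Y1 i" "u' \<in> X2 j" "v' \<in> Y2 j" "u @ ?m # v = u' @ ?m # v'"
      for i j u v u' v'
    proof -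
      have "u = u' \<and> v = v'" using that by (intro uniq) (auto simp: defs dest!: AvD OnceD)
      thus False using that by (auto simp: defs dest!: AvD OnceD)
    qed
    thus ?thesis unfolding joins_def by blast
  qed
  \<comment> \<open>The third family has \<open>j\<close> on the left and \<open>j + 1\<close> on
    the right, whereas in the first two the left word lies above the right one.\<close>
  have D3: "(joins ?m {..n} X1 Y1 \<union> joins ?m {..n} X2 Y2) \<inter> joins ?m {1..<n} X3 Y3 = {}"
  proof -
    have False if j: "j \<in> {1..<n}" and u': "u' \<in> X3 j" and v': "v' \<in> Y3 j"
      and *: "u \<in> X1 i \<and> v \<in> Y1 i \<or> u \<in> X2 i \<and> v \<in> Y2 i" and eq: "u @ ?m # v = u' @ ?m # v'"
      for i j u v u' v'
    proof -
      have su: "set u = {i+1..n}" "set v = {1..i}" using * by (auto simp: defs dest!: AvD OnceD)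
      have "u = u' \<and> v = v'" using su X3[OF j u'] eq by (intro uniq) auto
      moreover have "j \<in> set u'" using u' by (auto simp: X3_def)
      moreover have "Suc j \<in> set v'" using v' AvD unfolding Y3_def by blast
      ultimately show False using su by auto
    qed
    thus ?thesis unfolding joins_def by blast
  qed
  have "once (Suc r) (Suc n) = card (joins ?m {..n} X1 Y1 \<union> joins ?m {..n} X2 Y2 \<union> joins ?m {1..<n} X3 Y3)"
    unfolding once_def Once_Suc_decomposition defs ..
  also have "\<dots> = (\<Sum>i\<le>n. card (Y1 i) * card (X1 i)) + (\<Sum>i\<le>n. card (Y2 i) * card (X2 i)) +
      (\<Sum>i = 1..<n. card (Y3 i) * card (X3 i))"
    using J1 J2 J3 D12 D3 by (simp add: card_Un_disjoint)
  also have "(\<Sum>i\<le>n. card (Y1 i) * card (X1 i)) = (\<Sum>i\<le>n. av (Suc r) i * once r (n - i))"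
    by (rule sum.cong) (use card_Once_cong[of "{_+1..n}" r] in \<open>auto simp: av_def once_def defs\<close>)
  also have "(\<Sum>i\<le>n. card (Y2 i) * card (X2 i)) = (\<Sum>i\<le>n. once (Suc r) i * av r (n - i))"
    by (rule sum.cong) (use card_Av_cong[of "{_+1..n}" r] in \<open>auto simp: av_def once_def defs\<close>)
  also have "(\<Sum>i = 1..<n. card (Y3 i) * card (X3 i)) = (\<Sum>i = 1..<n. av (Suc r) i * av_snoc r (n - 1 - i))"
  proof (rule sum.cong[OF refl])
    fix i assume i: "i \<in> {1..<n}"
    have "card (X3 i) = card (Av_snoc r {i+2..n})"
      unfolding X3_def by (rule card_image) (auto simp: inj_on_def)
    also have "\<dots> = av_snoc r (n - 1 - i)"
      using card_Av_snoc_cong[of "{i+2..n}" r] by (simp add: av_snoc_def)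
    finally show "card (Y3 i) * card (X3 i) = av (Suc r) i * av_snoc r (n - 1 - i)"
      using card_Av_cong[of "{1..<i} \<union> {Suc i}" "Suc r"] cd[of i] i by (simp add: Y3_def av_def)
  qed
  finally show ?thesis .
qed

lemma num132_sorted: "sorted w \<Longrightarrow> num132 w = 0"
proof (induction w)
  case (Cons x w)
  have "num32_above x w = 0" if "sorted w" for w
    using that by (induction w) (auto simp: filter_empty_conv not_less)
  thus ?case using Cons by simp
qed simp

lemma av_0_right [simp]: "av r 0 = 1" and once_0_right [simp]: "once r 0 = 0"
proof -
  have "Av r {1..0} = {[]}" "Once r {1..0} = {}"
    by (auto simp: Av_def Once_def descent_rise_def)
  thus "av r 0 = 1" "once r 0 = 0" unfolding av_def once_def by simp_all
qed

text \<open>Avoiding 21 leaves only the increasing word, which contains no 1-3-2 either.\<close>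

lemma av_0_left: "av 0 n = 1"
proof -
  have "Av 0 {1..n} = {[1..<Suc n]}"
    by (auto simp: Av_def descent_rise_0_iff num132_sorted permutations_of_set_def
      simp del: upt_Suc intro: sorted_distinct_set_unique)
  thus ?thesis by (simp add: av_def)
qed

lemma once_0_left: "once 0 n = 0"
proof -
  have "Once 0 {1..n} = {}"
    by (auto simp: Once_def descent_rise_0_iff num132_sorted)
  thus ?thesis by (simp add: once_def)
qed

lemma av_snoc_0_left: "av_snoc 0 n = (if n = 0 then 1 else 0)"
proof -
  have "Av_snoc 0 {1..n} = (if n = 0 then {[]} else {})"
    by (auto simp: Av_snoc_def permutations_of_set_def)
  thus ?thesis by (simp add: av_snoc_def)
qed

lemma av_snoc_Suc_left: "av_snoc (Suc r) n = av (Suc r) n"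
  by (simp add: av_snoc_def av_def Av_snoc_def Av_def)

lemma h_eq_once: "h (pat_21_3_to (r + 2)) n = once r n"
  unfolding h_def once_def Once_def card_occurrences_132 avoids_21_3_to_iff by (simp add: conj_commute)

section \<open>Generating functions\<close>

definition Av_gf :: "nat \<Rightarrow> real fps" where "Av_gf r = Abs_fps (\<lambda>n. real (av r n))"
definition Once_gf :: "nat \<Rightarrow> real fps" where "Once_gf r = Abs_fps (\<lambda>n. real (once r n))"
definition Av_snoc_gf :: "nat \<Rightarrow> real fps" where "Av_snoc_gf r = Abs_fps (\<lambda>n. real (av_snoc r n))"

lemma Av_gf_Suc: "Av_gf (Suc r) = 1 + fps_X * (Av_gf (Suc r) * Av_gf r)"
proof (rule fps_ext)
  fix n
  have "(Av_gf (Suc r) * Av_gf r) $ m = real (av (Suc r) (Suc m))" for m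
    by (simp add: Av_gf_def fps_mult_nth av_Suc_Suc atLeast0AtMost)
  thus "Av_gf (Suc r) $ n = (1 + fps_X * (Av_gf (Suc r) * Av_gf r)) $ n"
    by (cases n) (simp_all add: Av_gf_def)
qed

text \<open>The factor \<open>fps_X ^ 2\<close> accounts for the maximum and the letter just before
  it; subtracting 1 discards the empty right-hand word, which cannot supply the letter 2 of the
  occurrence.\<close>

lemma Once_gf_Suc:
  "Once_gf (Suc r) = fps_X * (Av_gf (Suc r) * Once_gf r + Once_gf (Suc r) * Av_gf r)
     + fps_X ^ 2 * ((Av_gf (Suc r) - 1) * Av_snoc_gf r)"
proof (rule fps_ext)
  fix n
  show "Once_gf (Suc r) $ n = (fps_X * (Av_gf (Suc r) * Once_gf r + Once_gf (Suc r) * Av_gf r)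
     + fps_X ^ 2 * ((Av_gf (Suc r) - 1) * Av_snoc_gf r)) $ n"
  proof (cases n)
    case 0
    thus ?thesis by (simp add: Once_gf_def)
  next
    case (Suc m)
    have "(\<Sum>i = 1..<m. real (av (Suc r) i * av_snoc r (m - 1 - i)))
        = (fps_X * ((Av_gf (Suc r) - 1) * Av_snoc_gf r)) $ m"
    proof (cases m)
      case (Suc l)
      have "((Av_gf (Suc r) - 1) * Av_snoc_gf r) $ l
          = (\<Sum>i = 0..l. (Av_gf (Suc r) - 1) $ i * Av_snoc_gf r $ (l - i))"
        by (simp add: fps_mult_nth)
      \<comment> \<open>The constant coefficient of \<open>Av_gf (Suc r) - 1\<close> is 0, so the
        sum may start at 1.\<close>
      also have "\<dots> = (\<Sum>i = 1..l. (Av_gf (Suc r) - 1) $ i * Av_snoc_gf r $ (l - i))"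
        by (subst sum.atLeast_Suc_atMost) (simp_all add: Av_gf_def)
      also have "\<dots> = (\<Sum>i = 1..<m. real (av (Suc r) i * av_snoc r (m - 1 - i)))"
        by (rule sum.cong) (auto simp: Suc Av_gf_def Av_snoc_gf_def)
      finally show ?thesis by (simp add: Suc)
    qed simp
    moreover have "(Av_gf (Suc r) * Once_gf r + Once_gf (Suc r) * Av_gf r) $ m
        = (\<Sum>i\<le>m. real (av (Suc r) i * once r (m - i))) + (\<Sum>i\<le>m. real (once (Suc r) i * av r (m - i)))"
      by (simp add: Av_gf_def Once_gf_def fps_mult_nth atLeast0AtMost)
    moreover have "Once_gf (Suc r) $ n = real (once (Suc r) (Suc m))"
      by (simp add: Once_gf_def Suc)
    ultimately show ?thesis
      by (simp add: Suc power2_eq_square mult.assoc once_Suc_Suc)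
  qed
qed

lemma Av_gf_0: "Av_gf 0 * (1 - fps_X) = 1"
  by (rule fps_ext) (auto simp: Av_gf_def av_0_left algebra_simps split: nat.split)

lemma Once_gf_0: "Once_gf 0 = 0"
  by (rule fps_ext) (simp add: Once_gf_def once_0_left)

lemma Av_snoc_gf_0: "Av_snoc_gf 0 = 1"
  by (rule fps_ext) (simp add: Av_snoc_gf_def av_snoc_0_left)

lemma Av_snoc_gf_Suc: "Av_snoc_gf (Suc r) = Av_gf (Suc r)"
  by (simp add: Av_snoc_gf_def Av_gf_def av_snoc_Suc_left)

text \<open>\<open>W p\<close> is the polynomial \<open>x\<^bsup>p/2\<^esup> U\<^sub>p(1/(2\<surd>x))\<close>.\<close>

fun W :: "nat \<Rightarrow> real fps" where
  "W 0 = 1"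
| "W (Suc 0) = 1"
| "W (Suc (Suc p)) = W (Suc p) - fps_X * W p"

text \<open>The functional equation reads \<open>Av_gf (Suc r) * (1 - fps_X * Av_gf r) = 1\<close>;
  multiplied by \<open>W (r + 2)\<close>, it turns into the recurrence of \<open>W\<close>.\<close>

lemma Av_gf_W: "Av_gf r * W (r + 2) = W (r + 1)"
proof (induction r)
  case 0
  show ?case using Av_gf_0 by (simp add: numeral_2_eq_2)
next
  case (Suc r)
  have "Av_gf (Suc r) * W (Suc r + 2)
      = Av_gf (Suc r) * (W (r + 2) - fps_X * (Av_gf r * W (r + 2)))"
    using Suc by simp
  also have "\<dots> = (Av_gf (Suc r) - fps_X * (Av_gf (Suc r) * Av_gf r)) * W (r + 2)"
    by (simp add: algebra_simps)
  also have "Av_gf (Suc r) - fps_X * (Av_gf (Suc r) * Av_gf r) = 1"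
    using Av_gf_Suc[of r] by (simp add: algebra_simps)
  finally show ?case by simp
qed

text \<open>The equation is linear in \<open>Once_gf (Suc r)\<close> with coefficient
  \<open>1 - fps_X * Av_gf r\<close>, the quotient of \<open>W (r + 3)\<close> by
  \<open>W (r + 2)\<close>. Multiplying by both of these clears the denominators.\<close>

lemma Once_gf_W_Suc:
  "Once_gf (Suc r) * W (r + 3) ^ 2 =
     fps_X * (Once_gf r * W (r + 2) ^ 2) + fps_X ^ 3 * (W (r + 1) * (Av_snoc_gf r * W (r + 2)))"
proof -
  let ?F = "Av_gf r" and ?F' = "Av_gf (Suc r)" and ?O = "Once_gf r" and ?O' = "Once_gf (Suc r)"
    and ?S = "Av_snoc_gf r"
  define w1 w2 w3 where "w1 = W (r + 1)" and "w2 = W (r + 2)" and "w3 = W (r + 3)"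
  have F: "?F * w2 = w1" and F': "?F' * w3 = w2"
    using Av_gf_W[of r] Av_gf_W[of "Suc r"] by (simp_all add: w1_def w2_def w3_def eval_nat_numeral)
  have w3: "w3 = w2 - fps_X * w1" by (simp add: w1_def w2_def w3_def eval_nat_numeral)
  have O': "?O' - ?O' * (fps_X * ?F) = fps_X * (?F' * ?O) + fps_X ^ 2 * ((?F' - 1) * ?S)"
    using Once_gf_Suc[of r] by (simp add: algebra_simps)
  have "?O' * w3 ^ 2 = ?O' * (w2 - fps_X * (?F * w2)) * w3"
    unfolding F w3[symmetric] by (simp add: power2_eq_square)
  also have "\<dots> = (?O' - ?O' * (fps_X * ?F)) * w2 * w3"
    by (simp add: algebra_simps)
  also have "\<dots> = fps_X * (?F' * w3) * ?O * w2 + fps_X ^ 2 * (?F' * w3 - w3) * ?S * w2"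
    unfolding O' by (simp add: algebra_simps)
  also have "?F' * w3 - w3 = fps_X * w1"
    unfolding F' by (simp add: w3)
  finally have "?O' * w3 ^ 2 = fps_X * (?O * w2 ^ 2) + fps_X ^ 3 * (w1 * (?S * w2))"
    unfolding F' by (simp add: power2_eq_square power3_eq_cube mult_ac)
  thus ?thesis unfolding w1_def w2_def w3_def .
qed

text \<open>Iterates \<open>Once_gf_W_Suc\<close>. The base case gives
  \<open>fps_X ^ 3 * (1 - fps_X)\<close>, because \<open>Av_snoc_gf 0 = 1\<close>; its negative
  term, multiplied by \<open>fps_X\<close> at each step, becomes the final \<open>- 1\<close> of the
  theorem.\<close>

lemma Once_gf_W:
  "Once_gf (Suc r) * W (r + 3) ^ 2 = (\<Sum>j = 1..Suc r. fps_X ^ (r + 4 - j) * W j ^ 2) - fps_X ^ (r + 4)"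
proof (induction r)
  case 0
  have "Once_gf (Suc 0) * W 3 ^ 2 = fps_X ^ 3 * (1 - fps_X)"
    using Once_gf_W_Suc[of 0] by (simp add: Once_gf_0 Av_snoc_gf_0 numeral_2_eq_2)
  thus ?case by (simp add: algebra_simps eval_nat_numeral)
next
  case (Suc r)
  \<comment> \<open>At a positive index \<open>Av_snoc_gf\<close> equals \<open>Av_gf\<close>, so
    \<open>Av_gf_W\<close> turns the added term into a square of \<open>W\<close>.\<close>
  have "Once_gf (Suc (Suc r)) * W (Suc r + 3) ^ 2
      = fps_X * ((\<Sum>j = 1..Suc r. fps_X ^ (r + 4 - j) * W j ^ 2) - fps_X ^ (r + 4))
        + fps_X ^ 3 * W (Suc (Suc r)) ^ 2"
    using Once_gf_W_Suc[of "Suc r"] Suc Av_gf_W[of "Suc r"]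
    by (simp add: Av_snoc_gf_Suc power2_eq_square eval_nat_numeral)
  also have "\<dots> = (\<Sum>j = 1..Suc r. fps_X ^ (Suc r + 4 - j) * W j ^ 2)
      + fps_X ^ 3 * W (Suc (Suc r)) ^ 2 - fps_X ^ (Suc r + 4)"
  proof -
    have "fps_X * (fps_X ^ (r + 4 - j) * W j ^ 2) = fps_X ^ (Suc r + 4 - j) * W j ^ 2" if "j \<le> Suc r" for j
    proof -
      have "Suc r + 4 - j = Suc (r + 4 - j)" using that by simp
      thus ?thesis by (simp only: power_Suc mult.assoc)
    qed
    hence "(\<Sum>j = 1..Suc r. fps_X * (fps_X ^ (r + 4 - j) * W j ^ 2))
        = (\<Sum>j = 1..Suc r. fps_X ^ (Suc r + 4 - j) * W j ^ 2)"
      by (intro sum.cong) auto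
    thus ?thesis
      by (simp only: right_diff_distrib sum_distrib_left power_Suc[symmetric] add_Suc) (simp only: algebra_simps)
  qed
  also have "\<dots> = (\<Sum>j = 1..Suc (Suc r). fps_X ^ (Suc r + 4 - j) * W j ^ 2) - fps_X ^ (Suc r + 4)"
    by (simp add: eval_nat_numeral)
  finally show ?case .
qed

section \<open>From \<open>W\<close> to the Chebyshev polynomials\<close>

lemma U_at_Suc_Suc: "U_at (Suc (Suc p)) = U_at (Suc 0) * U_at (Suc p) - U_at p"
proof -
  have "fls_const (sum f A) = (\<Sum>x\<in>A. fls_const (f x :: real))" for f and A :: "nat set"
    by (induction A rule: infinite_finite_induct) (simp_all add: fls_plus_const[symmetric])
  \<comment> \<open>Embedding the coefficients respects products and differences, so the Chebyshev
    recurrence survives evaluation; its factor \<open>[:0, 2:]\<close> is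
    \<open>cheb_U_rec (Suc 0)\<close>.\<close>
  hence hom: "map_poly fls_const (a * b) = map_poly fls_const a * map_poly fls_const (b :: real poly)"
    "map_poly fls_const (a - b) = map_poly fls_const a - map_poly fls_const b" for a b
    by (intro poly_eqI; simp add: coeff_map_poly coeff_mult fls_const_mult_const fls_minus_const)+
  show ?thesis
    by (simp only: U_at_def cheb_U_eq_rec cheb_U_rec.simps hom poly_mult poly_diff)
qed

text \<open>The substitution of \<open>z^2\<close> for \<open>x\<close>, with \<open>z\<close> the
  Laurent variable standing for the square root. As a ring homomorphism it transports identities
  between power series.\<close>

definition sq_subst :: "real fps \<Rightarrow> real fls" where
  "sq_subst f = fps_to_fls (fps_compose f (fps_X ^ 2))"

lemma sq_subst_hom:
  "sq_subst 0 = 0" "sq_subst 1 = 1"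
  "sq_subst (f + g) = sq_subst f + sq_subst g" "sq_subst (f - g) = sq_subst f - sq_subst g"
  "sq_subst (f * g) = sq_subst f * sq_subst g"
  "sq_subst fps_X = fls_X ^ 2"
  by (simp_all add: sq_subst_def fps_compose_add_distrib fps_compose_sub_distrib
    fps_compose_mult_distrib fls_times_fps_to_fls fps_to_fls_power)

lemma sq_subst_power: "sq_subst (f ^ n) = sq_subst f ^ n"
  by (induction n) (simp_all add: sq_subst_hom)

lemma sq_subst_sum: "sq_subst (sum f A) = (\<Sum>x\<in>A. sq_subst (f x))"
  by (induction A rule: infinite_finite_induct) (simp_all add: sq_subst_hom)

lemma U_at_1_mult_X: "U_at (Suc 0) * fls_X = 1"
proof -
  have "(fls_X :: real fls) \<noteq> 0" by simp
  thus ?thesis using U_at_1 nonzero_eq_divide_eq by blast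
qed

text \<open>Multiplying the recurrence of \<open>U_at\<close> by \<open>fls_X ^ (p + 2)\<close>
  yields the image of the recurrence of \<open>W\<close>.\<close>

lemma U_at_W: "sq_subst (W p) = U_at p * fls_X ^ p"
proof (induction p rule: W.induct)
  case (3 p)
  have "U_at (Suc (Suc p)) * fls_X ^ Suc (Suc p)
      = (U_at (Suc 0) * fls_X) * (U_at (Suc p) * fls_X ^ Suc p) - fls_X ^ 2 * (U_at p * fls_X ^ p)"
    by (simp add: U_at_Suc_Suc algebra_simps power2_eq_square)
  thus ?case using 3 by (simp add: sq_subst_hom U_at_1_mult_X)
qed (simp_all add: sq_subst_hom U_at_0 U_at_1_mult_X)

theorem theorem4p3:
  fixes k :: nat
  assumes "k \<ge> 3"
  shows "fps_to_fls (fps_compose (H (pat_21_3_to k)) (fps_X ^ 2)) =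
    fls_X ^ 2 / (U_at k) ^ 2 * ((\<Sum>j = 1..k-2. (U_at j) ^ 2) - 1)"
proof -
  define r where "r = k - 3"
  have k: "k = r + 3" "k - 2 = Suc r" "k = Suc r + 2" using assms by (simp_all add: r_def)
  have H: "H (pat_21_3_to k) = Once_gf (Suc r)"
    unfolding H_def Once_gf_def k(3) h_eq_once ..
  let ?z = "fls_X :: real fls"
  \<comment> \<open>The constant term 1 makes \<open>W k\<close>, and hence \<open>U_at k\<close>,
    nonzero, which permits the final division.\<close>
  have W0: "W n $ 0 = 1" for n by (induction n rule: W.induct) simp_all
  have "fps_compose (W k) (fps_X ^ 2) $ 0 = 1" using W0[of k] by simp
  hence "sq_subst (W k) \<noteq> 0" unfolding sq_subst_def by (metis fps_to_fls_eq_0_iff fps_zero_nth zero_neq_one)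
  hence U: "U_at k \<noteq> 0" using U_at_W[of k] by auto
  have "sq_subst (Once_gf (Suc r)) * (U_at k * ?z ^ k) ^ 2
      = (\<Sum>j = 1..Suc r. (?z ^ 2) ^ (k + 1 - j) * (U_at j * ?z ^ j) ^ 2) - (?z ^ 2) ^ (k + 1)"
    using arg_cong[OF Once_gf_W[of r], of sq_subst]
    by (simp add: sq_subst_hom sq_subst_power sq_subst_sum U_at_W k(1) add.commute del: sum.cl_ivl_Suc)
  \<comment> \<open>The exponents \<open>2 * (k + 1 - j)\<close> and \<open>2 * j\<close> add up to
    \<open>2 * (k + 1)\<close>, so every summand carries the same power of \<open>z\<close>.\<close>
  also have "(\<Sum>j = 1..Suc r. (?z ^ 2) ^ (k + 1 - j) * (U_at j * ?z ^ j) ^ 2)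
      = (\<Sum>j = 1..Suc r. (?z ^ 2) ^ (k + 1) * U_at j ^ 2)"
  proof (rule sum.cong[OF refl])
    fix j assume "j \<in> {1..Suc r}"
    hence "(?z ^ 2) ^ (k + 1) = (?z ^ 2) ^ (k + 1 - j) * (?z ^ 2) ^ j"
      by (simp add: k(1) flip: power_add)
    thus "(?z ^ 2) ^ (k + 1 - j) * (U_at j * ?z ^ j) ^ 2 = (?z ^ 2) ^ (k + 1) * U_at j ^ 2"
      by (simp add: power_mult_distrib mult_ac flip: power_mult)
  qed
  \<comment> \<open>Of the power \<open>2 * (k + 1)\<close>, the part \<open>2 * k\<close> cancels
    against the left-hand side, and \<open>z^2\<close> remains.\<close>
  also have "\<dots> - (?z ^ 2) ^ (k + 1) = (?z ^ k) ^ 2 * (?z ^ 2 * ((\<Sum>j = 1..Suc r. U_at j ^ 2) - 1))"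
    by (simp add: sum_distrib_left right_diff_distrib power_mult_distrib mult_ac
      flip: power_mult del: sum.cl_ivl_Suc)
  finally have "sq_subst (Once_gf (Suc r)) * U_at k ^ 2 = ?z ^ 2 * ((\<Sum>j = 1..Suc r. U_at j ^ 2) - 1)"
    by (simp add: power_mult_distrib del: sum.cl_ivl_Suc)
  hence "sq_subst (Once_gf (Suc r)) = ?z ^ 2 / U_at k ^ 2 * ((\<Sum>j = 1..Suc r. U_at j ^ 2) - 1)"
    using U by (simp add: field_simps del: sum.cl_ivl_Suc)
  thus ?thesis unfolding H k(2) sq_subst_def .
qed

end
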